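(* Let $m_0\in\mathbb{R}$, let $V$ be a real-valued function analytic in a neighborhood of $m_0$ with $V(m_0)>0$, and let $\nu$ be a probability measure on $\mathbb{R}$ with all moments finite and $\int x\,\nu(dx)=m_0$. Then the following conditions are equivalent. (i) $\nu$ is non-degenerate, compactly supported, and there exists an open interval $(A,B)\ni m_0$ such that $$Q_m(dx)=\frac{V(m)}{V(m)+(m-m_0)(m-x)}\,\nu(dx),\qquad m\in(A,B),$$ defines a family of probability measures parameterized by the mean, with variance function $V$ (that is, $Q_m$ is a probability measure with mean $m$ and variance $V(m)$ for every $m\in(A,B)$). (ii) The free cumulants of $\nu$ are $c_1=m_0$ and, for $n\ge 1$, $$c_{n+1}=\frac{1}{n!}\left.\frac{d^{n-1}}{dx^{n-1}}\big(V(x)\big)^n\right|_{x=m_0}.$$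
   Context: A probability measure is non-degenerate if it is not a point mass. Free cumulants: for a compactly supported probability measure $\nu$ with Cauchy-Stieltjes transform $G_\nu(z)=\int\frac{1}{z-x}\nu(dx)$, the inverse function $K_\nu=G_\nu^{-1}$ exists for small $z\ne0$, the $R$-transform $R_\nu(z)=K_\nu(z)-1/z$ is analytic at $0$, and the free cumulants $c_n=c_n(\nu)$ are the coefficients in $R_\nu(z)=\sum_{n\ge1}c_n z^{n-1}$. For a probability measure with all moments finite, the free cumulants are the numbers $c_n$ determined (equivalently, in the compactly supported case) by the moment-cumulant relations $$\int x^n\,\nu(dx)=\sum_{\mathcal{V}\in\mathcal{NC}[n]}\ \prod_{B\in\mathcal{V}}c_{|B|},\qquad n\ge1,$$ where $\mathcal{NC}[n]$ is the set of non-crossing partitions of $\{1,\dots,n\}$. *)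

theory Defs
  imports "HOL-Analysis.Analysis" "HOL-Probability.Probability"
begin

definition real_analytic_on :: "(real \<Rightarrow> real) \<Rightarrow> real set \<Rightarrow> bool" where
  "real_analytic_on f U \<longleftrightarrow> (\<forall>x\<in>U. \<exists>F :: real fps. (\<lambda>h. f (x + h)) has_fps_expansion F)"

definition nondegenerate :: "real measure \<Rightarrow> bool" where
  "nondegenerate \<nu> \<longleftrightarrow> \<not> (\<exists>a. \<nu> = return borel a)"

definition compactly_supported :: "real measure \<Rightarrow> bool" where
  "compactly_supported \<nu> \<longleftrightarrow> (\<exists>K. compact K \<and> measure \<nu> K = 1)"

subsection \<open>Free cumulants\<close>

definition noncrossing :: "nat set set \<Rightarrow> bool" where
  "noncrossing P \<longleftrightarrow>
     \<not> (\<exists>B\<in>P. \<exists>C\<in>P. B \<noteq> C \<and>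
          (\<exists>a\<in>B. \<exists>b\<in>C. \<exists>c\<in>B. \<exists>d\<in>C. a < b \<and> b < c \<and> c < d))"

definition NC :: "nat \<Rightarrow> nat set set set" where
  "NC n = {P. partition_on {1..n} P \<and> noncrossing P}"

definition moment_cumulant_relations :: "real measure \<Rightarrow> (nat \<Rightarrow> real) \<Rightarrow> bool" where
  "moment_cumulant_relations \<nu> c \<longleftrightarrow>
     (\<forall>n\<ge>1. (\<integral>x. x ^ n \<partial>\<nu>) = (\<Sum>P\<in>NC n. \<Prod>B\<in>P. c (card B)))"

text \<open>The relations do not involve the value at index \<open>0\<close>; it is fixed to \<open>0\<close> so that
  they determine the whole sequence (lemma \<open>ex1_free_cumulant\<close> below).\<close>

definition free_cumulant :: "real measure \<Rightarrow> nat \<Rightarrow> real" where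
  "free_cumulant \<nu> = (THE c. c 0 = 0 \<and> moment_cumulant_relations \<nu> c)"

lemma finite_NC: "finite (NC n)"
  unfolding NC_def by (rule finite_subset[OF _ finitely_many_partition_on[of "{1..n}"]]) auto

lemma full_block_in_NC: "n \<ge> 1 \<Longrightarrow> {{1..n}} \<in> NC n"
  by (auto simp: NC_def noncrossing_def partition_on_def disjoint_def)

lemma card_block_less:
  assumes "P \<in> NC n - {{{1..n}}}" "B \<in> P"
  shows "card B < n"
proof -
  have P: "\<Union>P = {1..n}" "disjoint P" "{} \<notin> P" "P \<noteq> {{1..n}}"
    using assms by (auto simp: NC_def partition_on_def)
  have sub: "B \<subseteq> {1..n}" using P assms by auto
  have "B \<noteq> {1..n}"
  proof
    assume B: "B = {1..n}"
    have "C = B" if "C \<in> P" for C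
    proof (rule ccontr)
      assume "C \<noteq> B"
      then have "C \<inter> B = {}" using P(2) that assms(2) by (auto simp: disjoint_def)
      moreover have "C \<subseteq> B" using B P(1) that by auto
      ultimately have "C = {}" by auto
      then show False using P(3) that by simp
    qed
    then have "P = {B}" using assms(2) by blast
    then have "P = {{1..n}}" using B by simp
    then show False using P(4) by simp
  qed
  then have "B \<subset> {1..n}" using sub by auto
  then have "card B < card {1..n}" by (intro psubset_card_mono) auto
  then show ?thesis by simp
qed

lemma NC_sum_split:
  fixes c :: "nat \<Rightarrow> real"
  assumes "n \<ge> 1"
  shows "(\<Sum>P\<in>NC n. \<Prod>B\<in>P. c (card B)) =
           c n + (\<Sum>P\<in>NC n - {{{1..n}}}. \<Prod>B\<in>P. c (card B))"
  using sum.remove[OF finite_NC full_block_in_NC[OF assms], of "\<lambda>P. \<Prod>B\<in>P. c (card B)"] by simp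

lemma ex1_free_cumulant: "\<exists>!c. c 0 = 0 \<and> moment_cumulant_relations \<nu> c"
proof (rule ex_ex1I)
  define F :: "(nat \<Rightarrow> real) \<Rightarrow> nat \<Rightarrow> real" where
    "F = (\<lambda>f n. if n = 0 then 0
            else (\<integral>x. x ^ n \<partial>\<nu>) - (\<Sum>P\<in>NC n - {{{1..n}}}. \<Prod>B\<in>P. f (card B)))"
  define c where "c = wfrec less_than F"
  have c: "c n = F (cut c less_than n) n" for n
    unfolding c_def by (rule wfrec[OF wf_less_than])
  have c_F: "c n = F c n" for n
  proof -
    have "F (cut c less_than n) n = F c n"
    proof -
      have "cut c less_than n (card B) = c (card B)" if "P \<in> NC n - {{{1..n}}}" "B \<in> P" for P B
        using card_block_less[OF that] by (simp add: cut_apply)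
      then have "(\<Sum>P\<in>NC n - {{{1..n}}}. \<Prod>B\<in>P. cut c less_than n (card B)) =
            (\<Sum>P\<in>NC n - {{{1..n}}}. \<Prod>B\<in>P. c (card B))"
        by (intro sum.cong prod.cong refl) blast
      then show ?thesis unfolding F_def by presburger
    qed
    then show ?thesis using c by simp
  qed
  have "c 0 = 0" using c_F[of 0] unfolding F_def by simp
  moreover have "moment_cumulant_relations \<nu> c"
    unfolding moment_cumulant_relations_def
  proof (intro allI impI)
    fix n :: nat assume n: "n \<ge> 1"
    then show "(\<integral>x. x ^ n \<partial>\<nu>) = (\<Sum>P\<in>NC n. \<Prod>B\<in>P. c (card B))"
      using c_F[of n] NC_sum_split[OF n, of c] unfolding F_def by simp
  qed
  ultimately show "\<exists>c. c 0 = 0 \<and> moment_cumulant_relations \<nu> c" by blast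
next
  fix c d :: "nat \<Rightarrow> real"
  assume c: "c 0 = 0 \<and> moment_cumulant_relations \<nu> c"
    and d: "d 0 = 0 \<and> moment_cumulant_relations \<nu> d"
  have "c n = d n" for n
  proof (induction n rule: less_induct)
    case (less n)
    show ?case
    proof (cases "n = 0")
      case True
      then show ?thesis using c d by simp
    next
      case False
      then have n: "n \<ge> 1" by simp
      have "(\<Sum>P\<in>NC n - {{{1..n}}}. \<Prod>B\<in>P. c (card B)) =
            (\<Sum>P\<in>NC n - {{{1..n}}}. \<Prod>B\<in>P. d (card B))"
        by (intro sum.cong prod.cong refl less.IH) (rule card_block_less)
      moreover have "(\<Sum>P\<in>NC n. \<Prod>B\<in>P. c (card B)) = (\<Sum>P\<in>NC n. \<Prod>B\<in>P. d (card B))"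
        using c d n unfolding moment_cumulant_relations_def by metis
      ultimately show ?thesis
        using NC_sum_split[OF n, of c] NC_sum_split[OF n, of d] by linarith
    qed
  qed
  then show "c = d" by auto
qed

lemma moment_cumulant_relations_free_cumulant:
  "moment_cumulant_relations \<nu> (free_cumulant \<nu>)"
  using theI'[OF ex1_free_cumulant[of \<nu>]] unfolding free_cumulant_def by blast

subsection \<open>Families parameterized by the mean\<close>

definition kernel_density :: "(real \<Rightarrow> real) \<Rightarrow> real \<Rightarrow> real \<Rightarrow> real \<Rightarrow> real" where
  "kernel_density V m0 m x = V m / (V m + (m - m0) * (m - x))"

definition Q :: "(real \<Rightarrow> real) \<Rightarrow> real \<Rightarrow> real measure \<Rightarrow> real \<Rightarrow> real measure" where
  "Q V m0 \<nu> m = density \<nu> (\<lambda>x. ennreal (kernel_density V m0 m x))"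

text \<open>Since \<open>ennreal\<close> truncates negative numbers to \<open>0\<close> and division by \<open>0\<close> yields \<open>0\<close>,
  the first condition is needed: the density must be well defined and nonnegative
  \<open>\<nu>\<close>-almost everywhere, so that \<open>Q V m0 \<nu> m\<close> really is the (a priori signed)
  measure given by the formula.\<close>

definition mean_parameterized_family ::
  "(real \<Rightarrow> real) \<Rightarrow> real \<Rightarrow> real measure \<Rightarrow> real set \<Rightarrow> bool" where
  "mean_parameterized_family V m0 \<nu> I \<longleftrightarrow>
     (\<forall>m\<in>I.
        (AE x in \<nu>. V m + (m - m0) * (m - x) \<noteq> 0 \<and> kernel_density V m0 m x \<ge> 0) \<and>
        prob_space (Q V m0 \<nu> m) \<and>
        integrable (Q V m0 \<nu> m) (\<lambda>x. x) \<and>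
        (\<integral>x. x \<partial>Q V m0 \<nu> m) = m \<and>
        integrable (Q V m0 \<nu> m) (\<lambda>x. (x - m)\<^sup>2) \<and>
        (\<integral>x. (x - m)\<^sup>2 \<partial>Q V m0 \<nu> m) = V m)"

end

(* Write M for the moment series of nu, R for its R-transform, phi for the expansion of V at m0,
   and F = X / phi.  Peeling off the block of the least point of a non-crossing partition turns the
   moment-cumulant relations into M = 1 + X M (R o X M).  By Lagrange inversion the formula for the
   cumulants says R o F = m0 + X.  On the other side, with theta = (m - m0) / V m = F(m - m0), the kernel is
   1 / (1 + theta (m - x)), so "Q_m has mass one near m0" says M(theta / N) = N with
   N = 1 + theta m; the functional equation of M makes this equivalent to R o F = m0 + X.
   Mean and variance of Q_m come for free from the mass.  Compactness of the support in (ii) => (i):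
   R - m0 and X M both solve a fixed point equation P = X (C o P) with C convergent, hence converge,
   so the moments grow at most exponentially. *)
theory Submission
  imports Defs "HOL-Complex_Analysis.Complex_Analysis"
begin

unbundle no vec_syntax and fps_syntax

section \<open>Non-crossing partitions\<close>

text \<open>Removing the block of the least point in one step would produce a product over all its
  gaps. The block is instead shortened one point at a time: its second point \<open>j\<close>
  separates the gap before \<open>j\<close> from a rooted partition of the interval that starts at
  \<open>j\<close>. The shortened block must keep the weight of the original one, hence a second
  sequence \<open>d\<close> for the root block, shifted at every step; these shifts are Horner's
  scheme for R o XM. The analytic side is a statement about germs in m - m0, and germs agree exactly
  when their expansions do. So one chain of equivalences serves both implications, once the support
  is known to be bounded: the expansion of the kernel integral comes from integrating a geometric
  series term by term. In (ii) => (i) the bound must therefore be proved before the mass is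
  considered. At m = m0 the kernel is 1 and the mass carries no information; there the variance is
  the second cumulant.\<close>

definition nc_partitions :: "nat set \<Rightarrow> nat set set set" where
  "nc_partitions S = {P. partition_on S P \<and> noncrossing P}"

text \<open>The block \<open>B\<close> of the least point is kept apart from the other blocks
  \<open>P\<close>, because it alone is altered by the recursion. It is never a member of
  \<open>P\<close>, since \<open>P\<close> does not cover \<open>a\<close>.\<close>

definition rooted_nc :: "nat \<Rightarrow> nat \<Rightarrow> (nat set \<times> nat set set) set" where
  "rooted_nc a b = {(B, P). a \<in> B \<and> B \<subseteq> {a..<b} \<and> partition_on ({a..<b} - B) P \<and> noncrossing (insert B P)}"

definition nc_weight :: "(nat \<Rightarrow> real) \<Rightarrow> nat set \<Rightarrow> real" where
  "nc_weight c S = (\<Sum>P\<in>nc_partitions S. \<Prod>B\<in>P. c (card B))"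

definition rooted_weight :: "(nat \<Rightarrow> real) \<Rightarrow> (nat \<Rightarrow> real) \<Rightarrow> nat \<Rightarrow> nat \<Rightarrow> real" where
  "rooted_weight c d a b = (\<Sum>(B, P)\<in>rooted_nc a b. d (card B) * (\<Prod>C\<in>P. c (card C)))"

lemma finite_nc_partitions: "finite S \<Longrightarrow> finite (nc_partitions S)"
  unfolding nc_partitions_def by (rule finite_subset[OF _ finitely_many_partition_on[of S]]) auto

lemma nc_partitions_finite: "P \<in> nc_partitions S \<Longrightarrow> finite S \<Longrightarrow> finite P"
  using finite_elements unfolding nc_partitions_def by auto

lemma rooted_nc_finite: "(B, P) \<in> rooted_nc a b \<Longrightarrow> finite P \<and> finite B"
  using finite_elements[of "{a..<b} - B" P] finite_subset[of B "{a..<b}"] unfolding rooted_nc_def by auto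

lemma insert_root_bij:
  assumes "a < b"
  shows "bij_betw (\<lambda>(B, P). insert B P) (rooted_nc a b) (nc_partitions {a..<b})"
proof (rule bij_betw_imageI)
  have not_in: "B \<notin> P" if "(B, P) \<in> rooted_nc a b" for B P
    using that unfolding rooted_nc_def partition_on_def by auto
  show "inj_on (\<lambda>(B, P). insert B P) (rooted_nc a b)"
  proof (rule inj_onI, clarify)
    fix B P B' P'
    assume 1: "(B, P) \<in> rooted_nc a b" and 2: "(B', P') \<in> rooted_nc a b"
      and eq: "insert B P = insert B' P'"
    \<comment> \<open>Both root blocks contain \<open>a\<close>, which the remaining blocks avoid,
      so the union shows which block is the root.\<close>
    have "B = B'"
    proof (rule ccontr)
      assume "B \<noteq> B'"
      then have "B' \<in> P" using eq by auto
      then show False using 1 2 unfolding rooted_nc_def partition_on_def by auto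
    qed
    then show "B = B' \<and> P = P'"
      using eq not_in[OF 1] not_in[OF 2] by auto
  qed
  show "(\<lambda>(B, P). insert B P) ` rooted_nc a b = nc_partitions {a..<b}"
  proof (intro equalityI subsetI)
    fix R assume "R \<in> (\<lambda>(B, P). insert B P) ` rooted_nc a b"
    then obtain B P where BP: "(B, P) \<in> rooted_nc a b" and R: "R = insert B P" by auto
    have "disjnt B (\<Union>P)" using BP unfolding rooted_nc_def partition_on_def disjnt_def by auto
    then show "R \<in> nc_partitions {a..<b}"
      using BP partition_on_insert[of B P "{a..<b}"] unfolding R nc_partitions_def rooted_nc_def by auto
  next
    fix R assume R: "R \<in> nc_partitions {a..<b}"
    then have "\<Union>R = {a..<b}" "disjoint R" unfolding nc_partitions_def partition_on_def by auto
    have "a \<in> \<Union>R" unfolding \<open>\<Union>R = {a..<b}\<close> using assms by simp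
    then obtain B where B: "B \<in> R" "a \<in> B" by (rule UnionE)
    have "disjnt B (\<Union>(R - {B}))"
      using B \<open>disjoint R\<close> by (fastforce simp: disjnt_def disjoint_def)
    moreover have "insert B (R - {B}) = R" using B by auto
    ultimately have "(B, R - {B}) \<in> rooted_nc a b"
      using B R partition_on_insert[of B "R - {B}" "{a..<b}"] unfolding nc_partitions_def rooted_nc_def by auto
    then show "R \<in> (\<lambda>(B, P). insert B P) ` rooted_nc a b"
      using \<open>insert B (R - {B}) = R\<close> by (intro image_eqI[of _ _ "(B, R - {B})"]) auto
  qed
qed

lemma finite_rooted_nc: "finite (rooted_nc a b)"
proof (cases "a < b")
  case True
  then show ?thesis
    using bij_betw_finite[OF insert_root_bij[OF True]] finite_nc_partitions[of "{a..<b}"] by simp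
next
  case False
  then have "rooted_nc a b = {}" unfolding rooted_nc_def by auto
  then show ?thesis by simp
qed

lemma nc_weight_eq_rooted_weight:
  assumes "a < b"
  shows "nc_weight c {a..<b} = rooted_weight c c a b"
proof -
  have "nc_weight c {a..<b} = (\<Sum>x\<in>rooted_nc a b. \<Prod>C\<in>(case x of (B, P) \<Rightarrow> insert B P). c (card C))"
    unfolding nc_weight_def by (rule sum.reindex_bij_betw[OF insert_root_bij[OF assms], symmetric])
  also have "\<dots> = rooted_weight c c a b"
    unfolding rooted_weight_def
  proof (intro sum.cong refl, clarify)
    fix B P assume BP: "(B, P) \<in> rooted_nc a b"
    then have "B \<notin> P" "finite P"
      using rooted_nc_finite[OF BP] unfolding rooted_nc_def partition_on_def by auto
    then show "(\<Prod>C\<in>insert B P. c (card C)) = c (card B) * (\<Prod>C\<in>P. c (card C))" by simp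
  qed
  finally show ?thesis .
qed

section \<open>Joining and splitting rooted non-crossing partitions\<close>

definition join_root :: "nat \<Rightarrow> nat set set \<times> nat set \<times> nat set set \<Rightarrow> nat set \<times> nat set set" where
  "join_root a = (\<lambda>(P, B, R). (insert a B, P \<union> R))"

lemma noncrossingD:
  assumes "noncrossing P" "B \<in> P" "C \<in> P" "B \<noteq> C" "p \<in> B" "q \<in> C" "r \<in> B" "s \<in> C" "p < q" "q < r" "r < s"
  shows False
  using assms unfolding noncrossing_def by blast

text \<open>A crossing of two blocks of \<open>R\<close> is also one of the blocks of
  \<open>P\<close> around them, which the last assumption keeps distinct. This covers deleting a
  point from a block and dropping whole blocks.\<close>

lemma noncrossing_subset_blocks:
  assumes "noncrossing P" "\<And>B. B \<in> R \<Longrightarrow> \<exists>C\<in>P. B \<subseteq> C"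
    "\<And>B C D. B \<in> R \<Longrightarrow> C \<in> R \<Longrightarrow> B \<subseteq> D \<Longrightarrow> C \<subseteq> D \<Longrightarrow> D \<in> P \<Longrightarrow> B = C"
  shows "noncrossing R"
  unfolding noncrossing_def
proof clarify
  fix B C p q r s
  assume *: "B \<in> R" "C \<in> R" "B \<noteq> C" "p \<in> B" "q \<in> C" "r \<in> B" "s \<in> C" "p < q" "q < r" "r < s"
  obtain B' C' where BC: "B' \<in> P" "C' \<in> P" "B \<subseteq> B'" "C \<subseteq> C'" using assms(2) * by metis
  have "B' \<noteq> C'" using assms(3)[of B C B'] * BC by auto
  then show False using noncrossingD[OF assms(1), of B' C' p q r s] * BC by auto
qed

text \<open>The blocks of \<open>P\<close> lie strictly between \<open>a\<close> and
  \<open>j\<close>, all other points except \<open>a\<close> from \<open>j\<close> on; so only a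
  crossing through the added point \<open>a\<close> could be new.\<close>

lemma join_root_mem:
  assumes "a < j" "P \<in> nc_partitions {a+1..<j}" "(B, R) \<in> rooted_nc j b"
  shows "join_root a (P, B, R) \<in> rooted_nc a b"
proof -
  have P: "\<Union>P = {a+1..<j}" "disjoint P" "{} \<notin> P" "noncrossing P"
    using assms(2) unfolding nc_partitions_def partition_on_def by auto
  have R: "j \<in> B" "B \<subseteq> {j..<b}" "\<Union>R = {j..<b} - B" "disjoint R" "{} \<notin> R" "noncrossing (insert B R)"
    using assms(3) unfolding rooted_nc_def partition_on_def by auto
  have PS: "a < x \<and> x < j" if "C \<in> P" "x \<in> C" for C x using UnionI[OF that, unfolded P(1)] by simp
  have RS: "j \<le> x \<and> x \<notin> B" if "C \<in> R" "x \<in> C" for C x using UnionI[OF that, unfolded R(3)] by simp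
  have BS: "j \<le> x" if "x \<in> B" for x using R(2) that by auto
  have jb: "j < b" using R by auto
  have un: "\<Union>(P \<union> R) = {a..<b} - insert a B"
    unfolding Union_Un_distrib P(1) R(3) using assms(1) R(1,2) jb by auto
  have "C \<inter> D = {}" if "C \<in> P" "D \<in> R" for C D
    using PS[OF that(1)] RS[OF that(2)] by (meson disjoint_iff leD)
  then have "disjoint (P \<union> R)"
    using disjoint_union[OF P(2) R(4)] P(1) R(3) assms(1) by fastforce
  moreover have "noncrossing (insert (insert a B) (P \<union> R))"
    unfolding noncrossing_def
  proof clarify
    fix C D p q r s
    assume *: "C \<in> insert (insert a B) (P \<union> R)" "D \<in> insert (insert a B) (P \<union> R)" "C \<noteq> D"
      "p \<in> C" "q \<in> D" "r \<in> C" "s \<in> D" "p < q" "q < r" "r < s"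
    consider (bR) "C = insert a B" "D \<in> R" | (Rb) "C \<in> R" "D = insert a B"
      | (PP) "C \<in> P" "D \<in> P" | (RR) "C \<in> R" "D \<in> R"
      | (bP) "C = insert a B" "D \<in> P" | (Pb) "C \<in> P" "D = insert a B"
      | (PR) "C \<in> P" "D \<in> R" | (RP) "C \<in> R" "D \<in> P"
      using *(1-3) by auto
    then show False
    proof cases
      \<comment> \<open>The first point of the crossing, possibly \<open>a\<close>, is replaced by
        \<open>j\<close>, which lies in \<open>B\<close> and to the left of
        \<open>q\<close>.\<close>
      case bR
      have "j \<noteq> q" "j \<le> q" using RS[OF bR(2) *(5)] R(1) by auto
      moreover have "r \<in> B" using * bR \<open>j \<le> q\<close> assms(1) by auto
      moreover have "D \<noteq> B" using bR(2) R(1) RS by blast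
      ultimately show False
        using noncrossingD[OF R(6), of B D j q r s] bR * R(1) by auto
    next
      case Rb
      have "j \<le> p" using RS[OF Rb(1) *(4)] by auto
      then have "q \<in> B" "s \<in> B" using * Rb assms(1) by auto
      moreover have "C \<noteq> B" using Rb(1) R(1) RS by blast
      ultimately show False
        using noncrossingD[OF R(6), of C B p q r s] Rb * by auto
    next
      case PP then show False using noncrossingD[OF P(4), of C D p q r s] * by auto
    next
      case RR then show False using noncrossingD[OF R(6), of C D p q r s] * by auto
    next
      case bP
      then have "r \<in> B" using * PS[OF bP(2) *(5)] by auto
      then show False using BS[of r] PS[OF bP(2) *(7)] * by auto
    next
      case Pb
      then have "q \<in> B" using * PS[OF Pb(1) *(4)] by auto
      then show False using BS[of q] PS[OF Pb(1) *(6)] * by auto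
    next
      case PR then show False using PS[OF PR(1) *(6)] RS[OF PR(2) *(5)] * by auto
    next
      case RP then show False using PS[OF RP(2) *(5)] RS[OF RP(1) *(4)] * by auto
    qed
  qed
  ultimately show ?thesis
    unfolding join_root_def rooted_nc_def partition_on_def
    using un P(3) R(2,5) assms(1) jb by auto
qed

lemma root_singleton_iff:
  assumes "a < b"
  shows "({a}, P) \<in> rooted_nc a b \<longleftrightarrow> P \<in> nc_partitions {a+1..<b}"
proof -
  have eq: "{a..<b} - {a} = {a+1..<b}" by auto
  have "noncrossing (insert {a} P) \<longleftrightarrow> noncrossing P"
    by (auto simp: noncrossing_def)
  then show ?thesis using assms unfolding rooted_nc_def nc_partitions_def by (auto simp: eq)
qed

text \<open>Here \<open>j\<close> is the second point of the root block, and every other block falls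
  on one side of it.\<close>

lemma rooted_nc_split:
  assumes "(A, T) \<in> rooted_nc a b" "A \<noteq> {a}"
  obtains j P B R where "j \<in> {a+1..<b}" "P \<in> nc_partitions {a+1..<j}" "(B, R) \<in> rooted_nc j b"
    "(A, T) = join_root a (P, B, R)"
proof -
  define B where "B = A - {a}"
  define j where "j = Min B"
  define P where "P = {C\<in>T. C \<subseteq> {..<j}}"
  define R where "R = {C\<in>T. C \<subseteq> {j..}}"
  have T: "a \<in> A" "A \<subseteq> {a..<b}" "\<Union>T = {a..<b} - A" "disjoint T" "{} \<notin> T" "noncrossing (insert A T)"
    using assms(1) unfolding rooted_nc_def partition_on_def by auto
  have finB: "finite B" "B \<noteq> {}"
    using assms(2) T finite_subset[of A "{a..<b}"] unfolding B_def by auto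
  have jB: "j \<in> B" and jmin: "\<And>x. x \<in> B \<Longrightarrow> j \<le> x" using finB unfolding j_def by auto
  have j: "j \<in> {a+1..<b}" "j \<in> A" using jB T unfolding B_def by (auto simp: le_less Suc_le_eq)
  have QA: "x \<in> {a..<b} \<and> x \<notin> A" if "C \<in> T" "x \<in> C" for C x using T(3) that by blast
  \<comment> \<open>A block with points \<open>x < j < y\<close> would cross the root block at
    \<open>a < x < j < y\<close>.\<close>
  have dich: "C \<subseteq> {..<j} \<or> C \<subseteq> {j..}" if C: "C \<in> T" for C
  proof (rule ccontr)
    assume "\<not> ?thesis"
    then obtain x y where xy: "x \<in> C" "x < j" "y \<in> C" "j \<le> y" by force
    have "y \<noteq> j" "x \<noteq> a" "a \<le> x" using QA[OF C xy(1)] QA[OF C xy(3)] j T by auto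
    then have "a < x" "x < j" "j < y" using xy by auto
    moreover have "C \<noteq> A" using QA[OF C xy(1)] xy by auto
    ultimately show False using noncrossingD[OF T(6), of A C a x j y] T(1) j(2) xy C by auto
  qed
  have QPR: "T = P \<union> R" using dich unfolding P_def R_def by auto
  have "\<Union>P = {a+1..<j}"
  proof (intro equalityI subsetI)
    fix x assume "x \<in> \<Union>P"
    then obtain C where "C \<in> T" "x \<in> C" "x < j" unfolding P_def by auto
    then show "x \<in> {a+1..<j}" using QA[of C x] T(1) by (auto simp: Suc_le_eq le_less)
  next
    fix x assume x: "x \<in> {a+1..<j}"
    then have "x \<notin> B" using jmin[of x] by auto
    then have "x \<in> {a..<b} - A" using x j unfolding B_def by auto
    then obtain C where "C \<in> T" "x \<in> C" using T(3) by blast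
    then show "x \<in> \<Union>P" using dich[of C] x unfolding P_def by auto
  qed
  moreover have "noncrossing P" using T(6) unfolding P_def noncrossing_def by blast
  moreover have "disjoint P" using T(4) unfolding P_def disjoint_def by auto
  ultimately have 1: "P \<in> nc_partitions {a+1..<j}"
    using T(5) unfolding nc_partitions_def partition_on_def P_def by auto
  have "\<Union>R = {j..<b} - B"
  proof (intro equalityI subsetI)
    fix x assume "x \<in> \<Union>R"
    then obtain C where "C \<in> T" "x \<in> C" "j \<le> x" unfolding R_def by auto
    then show "x \<in> {j..<b} - B" using QA[of C x] unfolding B_def by auto
  next
    fix x assume x: "x \<in> {j..<b} - B"
    then have "x \<in> {a..<b} - A" using j unfolding B_def by auto
    then obtain C where "C \<in> T" "x \<in> C" using T(3) by blast
    then show "x \<in> \<Union>R" using dich[of C] x unfolding R_def by auto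
  qed
  moreover have "noncrossing (insert B R)"
  proof (rule noncrossing_subset_blocks[OF T(6)])
    show "\<exists>D\<in>insert A T. C \<subseteq> D" if "C \<in> insert B R" for C
      using that unfolding B_def R_def by auto
    have RT: "C \<in> T" "C \<noteq> {}" "C \<inter> A = {}" if "C \<in> R" for C
      using that T(5) QA[of C] unfolding R_def by auto
    have TT: "C = D" if "C \<in> T" "D \<in> T" "C \<inter> D \<noteq> {}" for C D
      using that T(4) unfolding disjoint_def by blast
    show "C = D" if CD: "C \<in> insert B R" "D \<in> insert B R" "C \<subseteq> E" "D \<subseteq> E" "E \<in> insert A T" for C D E
    proof (rule ccontr)
      assume "C \<noteq> D"
      then consider "C \<in> R" "D \<in> R" | "C \<in> R" "D = B" | "C = B" "D \<in> R" using CD(1,2) by auto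
      then show False
      proof cases
        case 1
        then have "E \<noteq> A" using RT[of C] CD(3) by auto
        then have "E \<in> T" using CD(5) by auto
        moreover have "C \<inter> E \<noteq> {}" "D \<inter> E \<noteq> {}"
          using RT(2)[of C] RT(2)[of D] 1 CD(3,4) by (simp_all add: Int_absorb2)
        ultimately show False using TT[of C E] TT[of D E] RT(1) 1 \<open>C \<noteq> D\<close> by metis
      next
        case 2
        then have "E = A" using CD(4,5) jB QA[of E j] j(2) by auto
        then show False using 2 RT[of C] CD(3) by auto
      next
        case 3
        then have "E = A" using CD(3,5) jB QA[of E j] j(2) by auto
        then show False using 3 RT[of D] CD(4) by auto
      qed
    qed
  qed
  moreover have "disjoint R" using T(4) unfolding R_def disjoint_def by auto
  moreover have "B \<subseteq> {j..<b}"
  proof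
    fix x assume "x \<in> B"
    then show "x \<in> {j..<b}" using jmin[of x] T(2) unfolding B_def by auto
  qed
  ultimately have 2: "(B, R) \<in> rooted_nc j b"
    using T(5) jB unfolding rooted_nc_def partition_on_def R_def by auto
  have "(A, T) = join_root a (P, B, R)" using T(1) QPR unfolding join_root_def B_def by auto
  with j(1) 1 2 show thesis by (rule that)
qed

text \<open>The image determines \<open>j\<close> and all three parts. This yields both the
  injectivity of the join for fixed \<open>j\<close> and the disjointness of the images for
  different \<open>j\<close>.\<close>

lemma join_root_decode:
  assumes "a < j" "P \<in> nc_partitions {a+1..<j}" "(B, R) \<in> rooted_nc j b" "join_root a (P, B, R) = (A, T)"
  shows "B = A - {a}" "j = Min (A - {a})" "P = {C\<in>T. C \<subseteq> {..<j}}" "R = {C\<in>T. C \<subseteq> {j..}}"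
proof -
  have P: "\<Union>P = {a+1..<j}" "{} \<notin> P" using assms(2) unfolding nc_partitions_def partition_on_def by auto
  have R: "j \<in> B" "B \<subseteq> {j..<b}" "\<Union>R = {j..<b} - B" "{} \<notin> R"
    using assms(3) unfolding rooted_nc_def partition_on_def by auto
  have AQ: "A = insert a B" "T = P \<union> R" using assms(4) unfolding join_root_def by auto
  show B: "B = A - {a}" using AQ R assms(1) by auto
  have "finite B" using R(2) finite_subset by auto
  then have "Min B = j" using R(1,2) by (intro Min_eqI) auto
  then show "j = Min (A - {a})" using B by simp
  have PS: "C \<subseteq> {..<j}" "C \<noteq> {}" if "C \<in> P" for C using P that by auto
  have RS: "C \<subseteq> {j..}" "C \<noteq> {}" if "C \<in> R" for C using R(3,4) that by fastforce+
  have no: "C = {}" if "C \<subseteq> {..<j}" "C \<subseteq> {j..}" for C using that by fastforce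
  show "P = {C\<in>T. C \<subseteq> {..<j}}"
  proof (rule set_eqI)
    fix C show "C \<in> P \<longleftrightarrow> C \<in> {C\<in>T. C \<subseteq> {..<j}}"
      using PS[of C] RS[of C] no[of C] unfolding AQ mem_Collect_eq Un_iff by metis
  qed
  show "R = {C\<in>T. C \<subseteq> {j..}}"
  proof (rule set_eqI)
    fix C show "C \<in> R \<longleftrightarrow> C \<in> {C\<in>T. C \<subseteq> {j..}}"
      using PS[of C] RS[of C] no[of C] unfolding AQ mem_Collect_eq Un_iff by metis
  qed
qed

text \<open>Splitting at the second element \<open>j\<close> of the block containing \<open>a\<close>: the points strictly
  between \<open>a\<close> and \<open>j\<close> are partitioned among themselves.\<close>
lemma rooted_weight_rec:
  assumes "a < b"
  shows "rooted_weight c d a b = d 1 * nc_weight c {a+1..<b} +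
    (\<Sum>j\<in>{a+1..<b}. nc_weight c {a+1..<j} * rooted_weight c (\<lambda>k. d (Suc k)) j b)"
proof -
  define w where "w = (\<lambda>(B :: nat set, P :: nat set set). d (card B) * (\<Prod>C\<in>P. c (card C)) :: real)"
  define S where "S j = nc_partitions {a+1..<j} \<times> rooted_nc j b" for j
  define S0 where "S0 = Pair {a} ` nc_partitions {a+1..<b}"
  have dec: "x \<in> S j \<Longrightarrow> j \<in> {a+1..<b} \<Longrightarrow> join_root a x = (A, T) \<Longrightarrow>
      x = ({C\<in>T. C \<subseteq> {..<j}}, A - {a}, {C\<in>T. C \<subseteq> {j..}}) \<and> j = Min (A - {a})"
    for x j A T
  proof -
    assume x: "x \<in> S j" "j \<in> {a+1..<b}" "join_root a x = (A, T)"
    obtain P B R where PBR: "x = (P, B, R)" by (cases x)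
    show ?thesis
      using join_root_decode[of a j P B R b A T] x unfolding PBR S_def by simp
  qed
  have inj: "inj_on (join_root a) (S j)" if "j \<in> {a+1..<b}" for j
  proof (rule inj_onI)
    fix x y assume xy: "x \<in> S j" "y \<in> S j" "join_root a x = join_root a y"
    obtain A T where x: "join_root a x = (A, T)" by (cases "join_root a x")
    then have y: "join_root a y = (A, T)" using xy(3) by simp
    show "x = y"
      by (rule trans[OF conjunct1[OF dec[OF xy(1) that x]] sym[OF conjunct1[OF dec[OF xy(2) that y]]]])
  qed
  have disj: "join_root a ` S i \<inter> join_root a ` S j = {}"
    if ij: "i \<in> {a+1..<b}" "j \<in> {a+1..<b}" "i \<noteq> j" for i j
  proof -
    have False if "x \<in> S i" "y \<in> S j" "join_root a x = join_root a y" for x y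
    proof -
      obtain A T where xe: "join_root a x = (A, T)" by (cases "join_root a x")
      then have ye: "join_root a y = (A, T)" using that(3) by simp
      show False
        using trans[OF conjunct2[OF dec[OF that(1) ij(1) xe]] sym[OF conjunct2[OF dec[OF that(2) ij(2) ye]]]]
          ij(3) by simp
    qed
    then show ?thesis by blast
  qed
  \<comment> \<open>A joined root block contains some \<open>j > a\<close>, so it is never the
    singleton root that makes up \<open>S0\<close>.\<close>
  have rootne: "fst (join_root a x) \<noteq> {a}" if "x \<in> S j" "j \<in> {a+1..<b}" for x j
    using that unfolding S_def join_root_def rooted_nc_def by (auto simp: subset_singleton_iff)
  have decomp: "rooted_nc a b = S0 \<union> (\<Union>j\<in>{a+1..<b}. join_root a ` S j)"
  proof (intro equalityI subsetI)
    fix x assume x: "x \<in> rooted_nc a b"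
    obtain A T where AQ: "x = (A, T)" by (cases x)
    show "x \<in> S0 \<union> (\<Union>j\<in>{a+1..<b}. join_root a ` S j)"
    proof (cases "A = {a}")
      case True
      then show ?thesis using x AQ root_singleton_iff[OF assms] unfolding S0_def by auto
    next
      case False
      then obtain j P B R where "j \<in> {a+1..<b}" "P \<in> nc_partitions {a+1..<j}" "(B, R) \<in> rooted_nc j b"
        "(A, T) = join_root a (P, B, R)" using rooted_nc_split x AQ by blast
      then show ?thesis unfolding AQ S_def by blast
    qed
  next
    fix x assume "x \<in> S0 \<union> (\<Union>j\<in>{a+1..<b}. join_root a ` S j)"
    then consider P where "P \<in> nc_partitions {a+1..<b}" "x = ({a}, P)"
      | j P B R where "j \<in> {a+1..<b}" "P \<in> nc_partitions {a+1..<j}" "(B, R) \<in> rooted_nc j b"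
        "x = join_root a (P, B, R)"
      unfolding S0_def S_def by (elim UnE imageE UN_E SigmaE) auto
    then show "x \<in> rooted_nc a b"
    proof cases
      case 1
      then show ?thesis using root_singleton_iff[OF assms] by simp
    next
      case 2
      then show ?thesis using join_root_mem[of a j P B R b] by simp
    qed
  qed
  have finS: "finite (S j)" for j unfolding S_def by (simp add: finite_nc_partitions finite_rooted_nc)
  have "rooted_weight c d a b = sum w (rooted_nc a b)" unfolding rooted_weight_def w_def by simp
  also have "\<dots> = sum w S0 + sum w (\<Union>j\<in>{a+1..<b}. join_root a ` S j)"
    unfolding decomp
  proof (rule sum.union_disjoint)
    show "finite S0" unfolding S0_def by (simp add: finite_nc_partitions)
    show "S0 \<inter> (\<Union>j\<in>{a+1..<b}. join_root a ` S j) = {}"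
    proof (rule equals0I)
      fix x assume x: "x \<in> S0 \<inter> (\<Union>j\<in>{a+1..<b}. join_root a ` S j)"
      then obtain j y where "j \<in> {a+1..<b}" "y \<in> S j" "x = join_root a y" by (elim IntE UN_E imageE)
      moreover have "x \<in> S0" using x by (rule IntD1)
      then have "fst x = {a}" unfolding S0_def by (elim imageE) simp
      ultimately show False using rootne by simp
    qed
  qed (use finS in auto)
  also have "sum w S0 = d 1 * nc_weight c {a+1..<b}"
    unfolding S0_def nc_weight_def by (simp add: sum.reindex inj_on_def w_def sum_distrib_left)
  also have "sum w (\<Union>j\<in>{a+1..<b}. join_root a ` S j) = (\<Sum>j\<in>{a+1..<b}. sum w (join_root a ` S j))"
    by (rule sum.UNION_disjoint) (use finS disj in auto)
  also have "\<dots> = (\<Sum>j\<in>{a+1..<b}. nc_weight c {a+1..<j} * rooted_weight c (\<lambda>k. d (Suc k)) j b)"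
  proof (intro sum.cong refl)
    fix j assume j: "j \<in> {a+1..<b}"
    have "sum w (join_root a ` S j) = (\<Sum>x\<in>S j. w (join_root a x))"
      by (rule sum.reindex[OF inj[OF j], unfolded o_def])
    also have "\<dots> = (\<Sum>(P, B, R)\<in>S j. (\<Prod>C\<in>P. c (card C)) * (d (Suc (card B)) * (\<Prod>C\<in>R. c (card C))))"
    proof (intro sum.cong refl, clarify)
      fix P B R assume x: "(P, B, R) \<in> S j"
      have fin: "finite P" "finite R" "finite B"
        using x nc_partitions_finite[of P] rooted_nc_finite[of B R] unfolding S_def by auto
      have "a \<notin> B" using x j unfolding S_def rooted_nc_def by auto
      have "P \<inter> R = {}"
      proof -
        have "\<Union>P \<subseteq> {..<j}" "\<Union>R \<subseteq> {j..}" "{} \<notin> P"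
          using x unfolding S_def rooted_nc_def nc_partitions_def partition_on_def by auto
        then have "C = {}" if "C \<in> P" "C \<in> R" for C using that by fastforce
        then show ?thesis using \<open>{} \<notin> P\<close> by blast
      qed
      then show "w (join_root a (P, B, R)) =
          (\<Prod>C\<in>P. c (card C)) * (d (Suc (card B)) * (\<Prod>C\<in>R. c (card C)))"
        using fin \<open>a \<notin> B\<close> unfolding w_def join_root_def by (simp add: prod.union_disjoint)
    qed
    also have "\<dots> = nc_weight c {a+1..<j} * rooted_weight c (\<lambda>k. d (Suc k)) j b"
      unfolding S_def nc_weight_def rooted_weight_def
      by (simp add: sum.cartesian_product sum_product case_prod_unfold)
    finally show "sum w (join_root a ` S j) = nc_weight c {a+1..<j} * rooted_weight c (\<lambda>k. d (Suc k)) j b" .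
  qed
  finally show ?thesis .
qed

text \<open>Indexed by the length \<open>i\<close> of the gap: every interval is then given by its
  start and its length, the form that translation and convolution need.\<close>

lemma rooted_weight_rec_shift:
  "rooted_weight c d a (a + Suc n) = d 1 * nc_weight c {a+1..<a+1+n} +
    (\<Sum>i<n. nc_weight c {a+1..<a+1+i} * rooted_weight c (\<lambda>k. d (Suc k)) (a+1+i) (a+1+i + (n-i)))"
proof -
  have *: "(\<Sum>j\<in>{a+1..<a + Suc n}. f j) = (\<Sum>i<n. f (a+1+i))" for f :: "nat \<Rightarrow> real"
    by (rule sum.reindex_bij_witness[of _ "\<lambda>i. a+1+i" "\<lambda>j. j - (a+1)"]) auto
  have "a < a + Suc n" by simp
  then show ?thesis
    unfolding rooted_weight_rec[OF \<open>a < a + Suc n\<close>] *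
    by (intro arg_cong2[where f = "(+)"] sum.cong) auto
qed

lemma nc_weight_empty: "nc_weight c {} = 1"
proof -
  have "nc_partitions {} = {{}}" by (auto simp: nc_partitions_def partition_on_def noncrossing_def)
  then show ?thesis by (simp add: nc_weight_def)
qed

text \<open>The recursion sees only lengths, so translation invariance follows by induction, without
  a bijection between partitions. The two weights go together because both occur in the recursion,
  and \<open>d\<close> varies because it is shifted there.\<close>

lemma weight_translate:
  "nc_weight c {a..<a+n} = nc_weight c {b..<b+n} \<and>
   rooted_weight c d a (a+n) = rooted_weight c d b (b+n)"
proof (induction n arbitrary: a b d rule: less_induct)
  case (less n)
  show ?case
  proof (cases n)
    case 0
    have "rooted_nc x x = {}" for x unfolding rooted_nc_def by auto
    then show ?thesis using 0 by (simp add: rooted_weight_def)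
  next
    case (Suc m)
    have R: "rooted_weight c d a (a+n) = rooted_weight c d b (b+n)" for d
      unfolding Suc rooted_weight_rec_shift
    proof (intro arg_cong2[where f = "(+)"] arg_cong2[where f = "(*)"] sum.cong refl)
      show "nc_weight c {a+1..<a+1+m} = nc_weight c {b+1..<b+1+m}" using less.IH[of m "a+1" "b+1"] Suc by simp
      fix i assume "i \<in> {..<m}"
      then show "nc_weight c {a+1..<a+1+i} = nc_weight c {b+1..<b+1+i}"
        using less.IH[of i "a+1" "b+1"] Suc by simp
      show "rooted_weight c (\<lambda>k. d (Suc k)) (a+1+i) (a+1+i + (m-i))
          = rooted_weight c (\<lambda>k. d (Suc k)) (b+1+i) (b+1+i + (m-i))"
        using less.IH[of "m-i" "a+1+i" "b+1+i"] Suc by simp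
    qed
    then show ?thesis using nc_weight_eq_rooted_weight[of a "a+n" c] nc_weight_eq_rooted_weight[of b "b+n" c] Suc
      by simp
  qed
qed

section \<open>The moment series and its functional equation\<close>

definition nc_fps :: "(nat \<Rightarrow> real) \<Rightarrow> real fps" where
  "nc_fps c = Abs_fps (\<lambda>n. nc_weight c {0..<n})"

text \<open>Horner's scheme: with \<open>D d\<close> the series of the shifted \<open>d\<close>, one
  has \<open>D d = d 1 + X D d'\<close>, and substituting P = X M gives \<open>d 1\<close> + P
  (\<open>D d'\<close> o P). The first summand is a root block that ends here, the factor P a gap
  together with the next root point. The least point itself contributes no factor X, hence
  \<open>Suc n\<close> on the left against \<open>n\<close> on the right.\<close>

lemma rooted_weight_compose:
  "rooted_weight c d 0 (Suc n) =
    (nc_fps c * (Abs_fps (\<lambda>k. d (Suc k)) oo (fps_X * nc_fps c))) $ n"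
proof (induction n arbitrary: d rule: less_induct)
  case (less n)
  define M where "M = nc_fps c"
  define d' where "d' = (\<lambda>k. d (Suc k))"
  define D where "D e = Abs_fps (\<lambda>k. e (Suc k))" for e :: "nat \<Rightarrow> real"
  have IH: "rooted_weight c d' 0 (Suc k) = (M * (D d' oo (fps_X * M))) $ k" if "k < n" for k
    unfolding M_def D_def by (rule less.IH[OF that])
  have "D d = fps_const (d 1) + fps_X * D d'"
    unfolding D_def d'_def by (rule fps_ext) (simp add: fps_X_mult_nth)
  then have "D d oo (fps_X * M) = fps_const (d 1) + fps_X * M * (D d' oo (fps_X * M))"
    by (simp add: fps_compose_add_distrib fps_compose_mult_distrib)
  then have "(M * (D d oo (fps_X * M))) $ n = (fps_const (d 1) * M + fps_X * (M * (M * (D d' oo (fps_X * M))))) $ n"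
    by (simp add: algebra_simps)
  also have "\<dots> = d 1 * M $ n + (\<Sum>i<n. M $ i * (M * (D d' oo (fps_X * M))) $ (n - 1 - i))"
    by (cases n) (simp_all add: fps_mult_nth[of M "M * _"] atLeast0AtMost lessThan_Suc_atMost)
  also have "(\<Sum>i<n. M $ i * (M * (D d' oo (fps_X * M))) $ (n - 1 - i))
      = (\<Sum>i<n. M $ i * rooted_weight c d' 0 (n - i))"
  proof (intro sum.cong refl)
    fix i assume "i \<in> {..<n}"
    then show "M $ i * (M * (D d' oo (fps_X * M))) $ (n - 1 - i) = M $ i * rooted_weight c d' 0 (n - i)"
      using IH[of "n - 1 - i"] by (simp add: Suc_diff_Suc)
  qed
  also have "d 1 * M $ n + \<dots> = rooted_weight c d 0 (0 + Suc n)"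
    unfolding rooted_weight_rec_shift
  proof (intro arg_cong2[where f = "(+)"] arg_cong2[where f = "(*)"] sum.cong refl)
    have M: "M $ k = nc_weight c {0 + 1..<0 + 1 + k}" for k
      using weight_translate[of c 0 k 1] by (simp add: M_def nc_fps_def)
    show "M $ n = nc_weight c {0 + 1..<0 + 1 + n}" by (rule M)
    fix i
    show "M $ i = nc_weight c {0 + 1..<0 + 1 + i}" by (rule M)
    show "rooted_weight c d' 0 (n - i) = rooted_weight c (\<lambda>k. d (Suc k)) (0 + 1 + i) (0 + 1 + i + (n - i))"
      using weight_translate[of c 0 "n - i" "0 + 1 + i" d'] by (simp add: d'_def)
  qed
  finally show ?case unfolding M_def D_def by simp
qed

text \<open>The case \<open>d = c\<close>, in which the root block is weighted like the others; the
  leading \<open>fps_X\<close> accounts for the least point.\<close>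

theorem nc_fps_functional_equation:
  "nc_fps c = 1 + fps_X * nc_fps c * (Abs_fps (\<lambda>k. c (Suc k)) oo (fps_X * nc_fps c))"
proof (rule fps_ext)
  fix n
  show "nc_fps c $ n = (1 + fps_X * nc_fps c * (Abs_fps (\<lambda>k. c (Suc k)) oo (fps_X * nc_fps c))) $ n"
  proof (cases n)
    case 0
    then show ?thesis by (simp add: nc_fps_def nc_weight_empty)
  next
    case (Suc m)
    then show ?thesis
      using rooted_weight_compose[of c c m] nc_weight_eq_rooted_weight[of 0 n c]
      by (simp add: nc_fps_def mult.assoc)
  qed
qed

lemma nc_fps_moments:
  assumes "moment_cumulant_relations \<nu> c" "prob_space \<nu>"
  shows "nc_fps c = Abs_fps (\<lambda>n. \<integral>x. x ^ n \<partial>\<nu>)"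
proof (rule fps_ext)
  fix n
  have "nc_weight c {0..<n} = (\<integral>x. x ^ n \<partial>\<nu>)"
  \<comment> \<open>The relations begin at \<open>n = 1\<close>; the constant term 1 is the total
    mass.\<close>
  proof (cases "n = 0")
    case True
    then show ?thesis using prob_space.prob_space[OF assms(2)] by (simp add: nc_weight_empty)
  next
    case False
    have "nc_weight c {0..<n} = nc_weight c {1..<1+n}"
      using weight_translate[of c 0 n 1] by simp
    also have "{1..<1+n} = {1..n}" by auto
    also have "nc_weight c {1..n} = (\<integral>x. x ^ n \<partial>\<nu>)"
      using assms(1) False unfolding moment_cumulant_relations_def nc_weight_def nc_partitions_def NC_def by auto
    finally show ?thesis .
  qed
  then show "nc_fps c $ n = Abs_fps (\<lambda>n. \<integral>x. x ^ n \<partial>\<nu>) $ n" by (simp add: nc_fps_def)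
qed

section \<open>Formal power series\<close>

lemma fps_mult_compose_nth:
  fixes a b c :: "real fps"
  assumes "c $ 0 = 0"
  shows "(a * (b oo c)) $ m = (\<Sum>i=0..m. b $ i * (a * c ^ i) $ m)"
proof -
  \<comment> \<open>The power \<open>c ^ i\<close> has no terms below degree \<open>i\<close>, so
    one range of summation serves all degrees \<open>k \<le> m\<close>, and the sums can be
    swapped.\<close>
  have "(b oo c) $ k = (\<Sum>i=0..m. b $ i * c ^ i $ k)" if "k \<le> m" for k
    unfolding fps_compose_nth using that startsby_zero_power_prefix[OF assms]
    by (intro sum.mono_neutral_left) auto
  then have "(a * (b oo c)) $ m = (\<Sum>k=0..m. \<Sum>i=0..m. a $ k * (b $ i * c ^ i $ (m - k)))"
    by (simp add: fps_mult_nth sum_distrib_left)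
  also have "\<dots> = (\<Sum>i=0..m. \<Sum>k=0..m. a $ k * (b $ i * c ^ i $ (m - k)))"
    by (rule sum.swap)
  also have "\<dots> = (\<Sum>i=0..m. b $ i * (a * c ^ i) $ m)"
    by (simp add: fps_mult_nth sum_distrib_left mult.left_commute)
  finally show ?thesis .
qed

text \<open>The formal residue of \<open>F ^ k * F' / F ^ n\<close>, multiplied by a power of \<open>X\<close> so that no
  Laurent series are needed.\<close>
lemma lagrange_residue:
  fixes \<phi> :: "real fps"
  assumes \<phi>: "\<phi> $ 0 \<noteq> 0" and k: "k < n"
  defines "F \<equiv> fps_X * inverse \<phi>"
  shows "(\<phi> ^ n * fps_deriv F * F ^ k) $ (n - 1) = (if Suc k = n then 1 else 0)"
proof -
  define \<psi> where "\<psi> = inverse \<phi>"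
  define j where "j = n - Suc k"
  have n: "n = Suc (k + j)" using k unfolding j_def by simp
  have inv: "\<phi> * \<psi> = 1" unfolding \<psi>_def using \<phi> by (simp add: inverse_mult_eq_1')
  have "fps_deriv (\<phi> * \<psi>) = 0" unfolding inv by simp
  then have d: "\<phi> * fps_deriv \<psi> = - (fps_deriv \<phi> * \<psi>)"
    by (simp add: eq_neg_iff_add_eq_0 algebra_simps)
  have pk: "\<phi> ^ k * \<psi> ^ k = 1" using inv by (simp flip: power_mult_distrib)
  have "\<phi> ^ n * fps_deriv F * F ^ k
      = (\<phi> ^ k * \<psi> ^ k) * (fps_X ^ k * \<phi> ^ j * (\<phi> * \<psi> + fps_X * (\<phi> * fps_deriv \<psi>)))"
    unfolding F_def \<psi>_def[symmetric] n by (simp add: power_add power_mult_distrib algebra_simps)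
  also have "\<dots> = fps_X ^ k * (\<phi> ^ j - fps_X * (\<phi> ^ j * \<psi> * fps_deriv \<phi>))"
    unfolding pk inv d by (simp add: algebra_simps)
  finally have "(\<phi> ^ n * fps_deriv F * F ^ k) $ (n - 1) = (\<phi> ^ j - fps_X * (\<phi> ^ j * \<psi> * fps_deriv \<phi>)) $ j"
    by (simp add: fps_X_power_mult_nth n)
  also have "\<dots> = (if j = 0 then 1 else 0)"
  proof (cases j)
    case 0
    then show ?thesis by simp
  next
    \<comment> \<open>For \<open>j > 0\<close> the two terms cancel: comparing coefficients in
      (\<phi>^j)' = j \<phi>^(j-1) \<phi>' shows that \<phi>^j in degree j agrees with \<phi>^(j-1)
      \<phi>' in degree j - 1.\<close>
    case (Suc i)
    have "\<phi> ^ j * \<psi> * fps_deriv \<phi> = (\<phi> * \<psi>) * (\<phi> ^ i * fps_deriv \<phi>)" unfolding Suc by (simp add: algebra_simps)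
    then have e: "\<phi> ^ j * \<psi> * fps_deriv \<phi> = \<phi> ^ i * fps_deriv \<phi>" unfolding inv by simp
    have "fps_deriv (\<phi> ^ j) = of_nat j * (\<phi> ^ i * fps_deriv \<phi>)"
      unfolding fps_deriv_power Suc by (simp add: fps_of_nat mult.assoc del: of_nat_Suc)
    then have "real j * (\<phi> ^ j) $ j = real j * (\<phi> ^ i * fps_deriv \<phi>) $ i"
      using arg_cong[where f = "\<lambda>f. f $ i"] fps_deriv_nth[of "\<phi> ^ j" i] Suc
      by (metis Suc_eq_plus1 fps_mult_of_nat_nth(1))
    then have "(\<phi> ^ j) $ j = (\<phi> ^ j * \<psi> * fps_deriv \<phi>) $ i" unfolding e using Suc by simp
    then show ?thesis using Suc by (simp only: fps_sub_nth fps_X_mult_nth) simp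
  qed
  finally show ?thesis by (simp add: n)
qed

text \<open>By the chain rule (W' o F) F' = 1, so this factor may be inserted next to \<phi>^n. When
  W' is expanded in powers of F, the residues keep only the power \<open>n - 1\<close>.\<close>

theorem lagrange_inversion:
  fixes \<phi> W :: "real fps"
  assumes \<phi>: "\<phi> $ 0 \<noteq> 0" and W: "W oo (fps_X * inverse \<phi>) = fps_X" and "n \<ge> 1"
  shows "real n * W $ n = (\<phi> ^ n) $ (n - 1)"
proof -
  define F where "F = fps_X * inverse \<phi>"
  have F0: "F $ 0 = 0" unfolding F_def by simp
  have "(fps_deriv W oo F) * fps_deriv F = 1"
    using fps_compose_deriv[OF F0, of W] W unfolding F_def by simp
  then have "(\<phi> ^ n) $ (n - 1) = (\<phi> ^ n * fps_deriv F * (fps_deriv W oo F)) $ (n - 1)"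
    by (simp add: mult.assoc mult.commute[of "fps_deriv F"])
  also have "\<dots> = (\<Sum>i=0..n-1. fps_deriv W $ i * (\<phi> ^ n * fps_deriv F * F ^ i) $ (n - 1))"
    by (rule fps_mult_compose_nth[OF F0])
  also have "\<dots> = (\<Sum>i=0..n-1. if i = n - 1 then real n * W $ n else 0)"
  proof (intro sum.cong refl)
    fix i assume "i \<in> {0..n-1}"
    then show "fps_deriv W $ i * (\<phi> ^ n * fps_deriv F * F ^ i) $ (n - 1) = (if i = n - 1 then real n * W $ n else 0)"
      using lagrange_residue[OF \<phi>, of i n, folded F_def] \<open>n \<ge> 1\<close> by auto
  qed
  also have "\<dots> = real n * W $ n" using \<open>n \<ge> 1\<close> by simp
  finally show ?thesis by simp
qed

text \<open>For the converse, the compositional inverse of F obeys the same formula, so the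
  coefficients force \<open>W\<close> to be that inverse.\<close>

lemma lagrange_inversion_iff:
  fixes \<phi> W :: "real fps"
  assumes \<phi>: "\<phi> $ 0 \<noteq> 0"
  shows "W oo (fps_X * inverse \<phi>) = fps_X \<longleftrightarrow> W $ 0 = 0 \<and> (\<forall>n\<ge>1. W $ n = (\<phi> ^ n) $ (n - 1) / real n)"
proof
  assume *: "W oo (fps_X * inverse \<phi>) = fps_X"
  then have "(W oo (fps_X * inverse \<phi>)) $ 0 = 0" by simp
  then show "W $ 0 = 0 \<and> (\<forall>n\<ge>1. W $ n = (\<phi> ^ n) $ (n - 1) / real n)"
    using lagrange_inversion[OF \<phi> *] by (auto simp: field_simps)
next
  assume W: "W $ 0 = 0 \<and> (\<forall>n\<ge>1. W $ n = (\<phi> ^ n) $ (n - 1) / real n)"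
  define F where "F = fps_X * inverse \<phi>"
  have F: "F $ 0 = 0" "F $ 1 \<noteq> 0" unfolding F_def using \<phi> by simp_all
  have inv: "fps_inv F oo F = fps_X" by (rule fps_inv[OF F])
  have "W $ n = fps_inv F $ n" for n
  proof (cases "n = 0")
    case True
    then show ?thesis using W by (simp add: fps_inv_def)
  next
    case False
    then have "fps_inv F $ n = (\<phi> ^ n) $ (n - 1) / real n"
      using lagrange_inversion[OF \<phi> inv[unfolded F_def], of n] unfolding F_def by (simp add: field_simps)
    then show ?thesis using W False by simp
  qed
  then have "W = fps_inv F" by (rule fps_ext)
  then show "W oo (fps_X * inverse \<phi>) = fps_X" using inv unfolding F_def by simp
qed

text \<open>With P = X M, the equation M o U = N says P o U = U N = F. Substituting U into the
  functional equation then gives N = 1 + F (R o F), to be compared with the definition of N.\<close>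

lemma moment_series_compose_iff:
  fixes M R F G N :: "real fps"
  assumes M: "M = 1 + fps_X * M * (R oo (fps_X * M))"
    and F: "F $ 0 = 0" "F $ 1 \<noteq> 0"
  defines "N \<equiv> 1 + F * G" and "U \<equiv> F * inverse N"
  shows "M oo U = N \<longleftrightarrow> R oo F = G"
proof
  have N0: "N $ 0 = 1" unfolding N_def using F by simp
  have NN: "inverse N * N = 1" using N0 by (simp add: inverse_mult_eq_1)
  have UN: "U * N = F" unfolding U_def by (simp add: mult.assoc NN)
  have U0: "U $ 0 = 0" unfolding U_def using F by simp
  have "F \<noteq> 0" using F by auto
  then have "U \<noteq> 0" using UN by auto
  define P where "P = fps_X * M"
  have P0: "P $ 0 = 0" unfolding P_def by simp
  have PU: "P oo U = U * (M oo U)"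
    unfolding P_def using U0 by (simp add: fps_compose_mult_distrib)
  {
    assume *: "M oo U = N"
    have "M oo U = 1 + (P * (R oo P) oo U)"
      using M unfolding P_def[symmetric] by (metis fps_compose_1 fps_compose_add_distrib)
    also have "\<dots> = 1 + (P oo U) * (R oo (P oo U))"
      by (simp add: fps_compose_mult_distrib[OF U0] fps_compose_assoc[OF U0 P0])
    finally have "F * G = F * (R oo F)" unfolding PU * UN by (simp add: N_def)
    then show "R oo F = G" using \<open>F \<noteq> 0\<close> by simp
  next
    assume *: "R oo F = G"
    \<comment> \<open>By the functional equation, L = X / (1 + X R) satisfies L o P = X, and R o F =
      G gives L o F = U. So L maps both P o U and F to U, and L can be cancelled.\<close>
    define C where "C = 1 + fps_X * R"
    define L where "L = fps_X * inverse C"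
    have C0: "C $ 0 \<noteq> 0" unfolding C_def by simp
    have CF: "C oo F = N"
      unfolding C_def N_def using F * by (simp add: fps_compose_add_distrib fps_compose_mult_distrib)
    have CP: "C oo P = M"
      unfolding C_def using P0 M by (simp add: fps_compose_add_distrib fps_compose_mult_distrib P_def)
    have "M $ 0 = 1" using arg_cong[OF M, of "\<lambda>f. f $ 0"] by simp
    then have "M * inverse M = 1" by (simp add: inverse_mult_eq_1')
    then have LP: "L oo P = fps_X"
      unfolding L_def using P0 C0 CP
      by (simp add: fps_compose_mult_distrib fps_inverse_compose P_def mult.assoc)
    have LF: "L oo F = U"
      unfolding L_def U_def using F C0 CF by (simp add: fps_compose_mult_distrib fps_inverse_compose)
    have L: "L $ 0 = 0" "L $ 1 \<noteq> 0" unfolding L_def using C0 by simp_all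
    have PU0: "(P oo U) $ 0 = 0" using P0 by simp
    have "L oo (P oo U) = L oo F"
      unfolding fps_compose_assoc[OF U0 P0] LP LF using U0 by simp
    then have "fps_inv L oo (L oo (P oo U)) = fps_inv L oo (L oo F)" by simp
    then have "P oo U = F"
      unfolding fps_compose_assoc[OF PU0 L(1)] fps_compose_assoc[OF F(1) L(1)] fps_inv[OF L]
      using PU0 F by simp
    then have "U * (M oo U) = U * N" unfolding PU UN .
    then show "M oo U = N" using \<open>U \<noteq> 0\<close> by simp
  }
qed

section \<open>Convergence of solutions of P = X (C o P)\<close>

definition trunc_norm :: "nat \<Rightarrow> real \<Rightarrow> real fps \<Rightarrow> real" where
  "trunc_norm N r f = (\<Sum>n\<le>N. \<bar>f $ n\<bar> * r ^ n)"

lemma trunc_norm_nonneg: "r \<ge> 0 \<Longrightarrow> trunc_norm N r f \<ge> 0"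
  unfolding trunc_norm_def by (intro sum_nonneg) simp

text \<open>The coefficients up to \<open>N\<close> of a product involve only a triangle of index
  pairs, part of the square on the right. The cut-off at \<open>N\<close> keeps the norm finite
  before any convergence is known.\<close>

lemma trunc_norm_mult:
  assumes "r \<ge> 0"
  shows "trunc_norm N r (f * g) \<le> trunc_norm N r f * trunc_norm N r g"
proof -
  have "trunc_norm N r (f * g) \<le> (\<Sum>n\<le>N. \<Sum>i\<le>n. (\<bar>f $ i\<bar> * r ^ i) * (\<bar>g $ (n - i)\<bar> * r ^ (n - i)))"
    unfolding trunc_norm_def
  proof (rule sum_mono)
    fix n assume "n \<in> {..N}"
    have "\<bar>(f * g) $ n\<bar> * r ^ n \<le> (\<Sum>i\<le>n. \<bar>f $ i * g $ (n - i)\<bar>) * r ^ n"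
      unfolding fps_mult_nth atLeast0AtMost using assms by (intro mult_right_mono sum_abs) simp
    also have "\<dots> = (\<Sum>i\<le>n. (\<bar>f $ i\<bar> * r ^ i) * (\<bar>g $ (n - i)\<bar> * r ^ (n - i)))"
      unfolding sum_distrib_right
      by (intro sum.cong refl) (simp add: abs_mult mult_ac flip: power_add)
    finally show "\<bar>(f * g) $ n\<bar> * r ^ n \<le> (\<Sum>i\<le>n. (\<bar>f $ i\<bar> * r ^ i) * (\<bar>g $ (n - i)\<bar> * r ^ (n - i)))" .
  qed
  also have "\<dots> = (\<Sum>(i, j)\<in>{(i, j). i + j \<le> N}. (\<bar>f $ i\<bar> * r ^ i) * (\<bar>g $ j\<bar> * r ^ j))"
    by (rule sum.triangle_reindex_eq[symmetric])
  also have "\<dots> \<le> (\<Sum>(i, j)\<in>{..N} \<times> {..N}. (\<bar>f $ i\<bar> * r ^ i) * (\<bar>g $ j\<bar> * r ^ j))"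
    using assms by (intro sum_mono2) (auto intro!: mult_nonneg_nonneg)
  also have "\<dots> = trunc_norm N r f * trunc_norm N r g"
    unfolding trunc_norm_def by (simp add: sum_product sum.cartesian_product)
  finally show ?thesis .
qed

lemma trunc_norm_power:
  assumes "r \<ge> 0"
  shows "trunc_norm N r (f ^ k) \<le> trunc_norm N r f ^ k"
proof (induction k)
  case 0
  have "trunc_norm N r 1 = (\<Sum>n\<le>N. if n = 0 then 1 else 0)"
    unfolding trunc_norm_def by (intro sum.cong refl) auto
  then show ?case by simp
next
  case (Suc k)
  have "trunc_norm N r (f ^ Suc k) \<le> trunc_norm N r f * trunc_norm N r (f ^ k)"
    unfolding power_Suc by (rule trunc_norm_mult[OF assms])
  also have "\<dots> \<le> trunc_norm N r f * trunc_norm N r f ^ k"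
    by (intro mult_left_mono Suc.IH trunc_norm_nonneg assms)
  finally show ?case by simp
qed

lemma trunc_norm_compose:
  assumes "r \<ge> 0" "g $ 0 = 0"
  shows "trunc_norm N r (f oo g) \<le> (\<Sum>k\<le>N. \<bar>f $ k\<bar> * trunc_norm N r g ^ k)"
proof -
  have "(f oo g) $ n = (\<Sum>k\<le>N. f $ k * g ^ k $ n)" if "n \<le> N" for n
    unfolding fps_compose_nth using that startsby_zero_power_prefix[OF assms(2)]
    by (intro sum.mono_neutral_left) auto
  then have "trunc_norm N r (f oo g) \<le> (\<Sum>n\<le>N. (\<Sum>k\<le>N. \<bar>f $ k * g ^ k $ n\<bar>) * r ^ n)"
    unfolding trunc_norm_def using assms(1) by (intro sum_mono mult_right_mono) (auto intro: sum_abs)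
  also have "\<dots> = (\<Sum>k\<le>N. \<bar>f $ k\<bar> * trunc_norm N r (g ^ k))"
    unfolding trunc_norm_def sum_distrib_right sum_distrib_left abs_mult mult.assoc by (rule sum.swap)
  also have "\<dots> \<le> (\<Sum>k\<le>N. \<bar>f $ k\<bar> * trunc_norm N r g ^ k)"
    by (intro sum_mono mult_left_mono trunc_norm_power assms) simp
  finally show ?thesis .
qed

text \<open>The factor \<open>fps_X\<close> makes the coefficients of \<open>P\<close> up to
  \<open>N + 1\<close> depend only on those up to \<open>N\<close>. Hence the bound \<rho> on the
  truncated norm reproduces itself as soon as \<open>r * S \<le> \<rho>\<close>, uniformly in
  \<open>N\<close>.\<close>

lemma fps_conv_radius_fixpoint:
  fixes C P :: "real fps"
  assumes P: "P = fps_X * (C oo P)" and C: "fps_conv_radius C > 0"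
  shows "fps_conv_radius P > 0"
proof -
  obtain \<rho> :: real where \<rho>: "\<rho> > 0" "ereal \<rho> < fps_conv_radius C"
    using ereal_dense2[OF C] by auto
  define S where "S = (\<Sum>k. \<bar>C $ k\<bar> * \<rho> ^ k)"
  have sm: "summable (\<lambda>k. \<bar>C $ k\<bar> * \<rho> ^ k)"
    using norm_summable_fps[of \<rho> C] \<rho> by (simp add: abs_mult power_abs)
  have "S \<ge> 0" unfolding S_def using \<rho> by (intro suminf_nonneg sm) simp
  \<comment> \<open>The added 1 keeps \<open>r\<close> positive when \<open>S = 0\<close>.\<close>
  define r where "r = \<rho> / (S + 1)"
  have r: "r > 0" "r * S \<le> \<rho>" unfolding r_def using \<rho> \<open>S \<ge> 0\<close> by (auto simp: field_simps)
  have P0: "P $ 0 = 0" using arg_cong[OF P, of "\<lambda>f. f $ 0"] by simp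
  have bound: "trunc_norm N r P \<le> \<rho>" for N
  proof (induction N)
    case 0
    then show ?case using P0 \<rho> by (simp add: trunc_norm_def)
  next
    case (Suc N)
    have "trunc_norm (Suc N) r P = r * trunc_norm N r (C oo P)"
      unfolding trunc_norm_def sum_distrib_left sum.atMost_Suc_shift
      by (subst (1 2) P) (simp add: P0 algebra_simps)
    also have "\<dots> \<le> r * (\<Sum>k\<le>N. \<bar>C $ k\<bar> * trunc_norm N r P ^ k)"
      using r P0 by (intro mult_left_mono trunc_norm_compose) auto
    also have "\<dots> \<le> r * (\<Sum>k\<le>N. \<bar>C $ k\<bar> * \<rho> ^ k)"
      using r Suc.IH by (intro mult_left_mono sum_mono power_mono trunc_norm_nonneg) auto
    also have "\<dots> \<le> r * S"
      unfolding S_def using r \<rho> by (intro mult_left_mono sum_le_suminf sm) auto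
    finally show ?case using r by simp
  qed
  have "\<bar>P $ n\<bar> * r ^ n \<le> \<rho>" for n
  proof -
    have "\<bar>P $ n\<bar> * r ^ n \<le> trunc_norm n r P"
      unfolding trunc_norm_def using r by (intro member_le_sum) auto
    then show ?thesis using bound[of n] by simp
  qed
  \<comment> \<open>Boundedness at radius \<open>r\<close> becomes summability at
    \<open>r / 2\<close>.\<close>
  then have "norm (P $ n * (r / 2) ^ n) \<le> \<rho> * (1 / 2) ^ n" for n
    using r mult_right_mono[of "\<bar>P $ n\<bar> * r ^ n" \<rho> "(1 / 2) ^ n"]
    by (simp add: abs_mult power_abs power_divide)
  moreover have "summable (\<lambda>n. \<rho> * (1 / 2) ^ n)"
    by (intro summable_mult summable_geometric) simp
  ultimately have "summable (\<lambda>n. P $ n * (r / 2) ^ n)"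
    by (rule summable_comparison_test'[rotated])
  then have "fps_conv_radius P \<ge> norm (r / 2)"
    unfolding fps_conv_radius_def by (rule conv_radius_geI)
  moreover have "0 < ereal (norm (r / 2))" using r by simp
  ultimately show ?thesis by (rule order.strict_trans2[rotated])
qed

section \<open>Composition and uniqueness of real expansions\<close>

definition complex_fps :: "real fps \<Rightarrow> complex fps" where
  "complex_fps F = Abs_fps (\<lambda>n. complex_of_real (F $ n))"

lemma complex_fps_nth [simp]: "complex_fps F $ n = of_real (F $ n)"
  by (simp add: complex_fps_def)

lemma complex_fps_power: "complex_fps F ^ k = complex_fps (F ^ k)"
proof (induction k)
  case 0
  then show ?case by (intro fps_ext) (simp add: fps_one_nth)
next
  case (Suc k)
  have "complex_fps F * complex_fps G = complex_fps (F * G)" for F G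
    by (intro fps_ext) (simp add: fps_mult_nth)
  then show ?case using Suc by simp
qed

lemma complex_fps_compose: "complex_fps F oo complex_fps G = complex_fps (F oo G)"
  by (intro fps_ext) (simp add: fps_compose_nth complex_fps_power)

lemma fps_conv_radius_complex_fps [simp]: "fps_conv_radius (complex_fps F) = fps_conv_radius F"
proof -
  have "conv_radius (\<lambda>n. norm (complex_of_real (F $ n))) = conv_radius (\<lambda>n. norm (F $ n))"
    by simp
  then show ?thesis unfolding fps_conv_radius_def conv_radius_norm by simp
qed

lemma eval_complex_fps:
  assumes "ereal \<bar>x\<bar> < fps_conv_radius F"
  shows "eval_fps (complex_fps F) (of_real x) = of_real (eval_fps F x)"
proof -
  have "(\<lambda>n. F $ n * x ^ n) sums eval_fps F x"
    using assms by (intro sums_eval_fps) simp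
  then have "(\<lambda>n. complex_of_real (F $ n * x ^ n)) sums of_real (eval_fps F x)"
    by (rule sums_of_real)
  then show ?thesis unfolding eval_fps_def by (simp add: sums_iff)
qed

text \<open>The composition is taken over the complex numbers and read off on the real axis, where
  both kinds of evaluation agree. The complex result also supplies the positive radius of
  \<open>F oo G\<close>.\<close>

lemma has_fps_expansion_compose_real:
  fixes f g :: "real \<Rightarrow> real"
  assumes f: "f has_fps_expansion F" and g: "g has_fps_expansion G" and G0: "G $ 0 = 0"
  shows "(\<lambda>x. f (g x)) has_fps_expansion (F oo G)"
proof -
  have r: "fps_conv_radius F > 0" "fps_conv_radius G > 0" using f g by (auto simp: has_fps_expansion_def)
  have "(eval_fps (complex_fps F) \<circ> eval_fps (complex_fps G)) has_fps_expansion (complex_fps F oo complex_fps G)"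
    by (rule has_fps_expansion_compose) (use r G0 in \<open>auto intro: eval_fps_has_fps_expansion\<close>)
  then have FG: "fps_conv_radius (F oo G) > 0"
    and ev: "\<forall>\<^sub>F z in nhds 0. eval_fps (complex_fps (F oo G)) z = eval_fps (complex_fps F) (eval_fps (complex_fps G) z)"
    unfolding complex_fps_compose by (auto simp: has_fps_expansion_def)
  have small: "\<forall>\<^sub>F x::real in nhds 0. ereal \<bar>x\<bar> < fps_conv_radius H" if "fps_conv_radius H > 0" for H :: "real fps"
    using eventually_nhds_in_open[of "eball (0::real) (fps_conv_radius H)" 0] that by (simp add: zero_ereal_def dist_real_def)
  have "((\<lambda>x. complex_of_real x) \<longlongrightarrow> of_real 0) (nhds 0)" by (intro tendsto_of_real filterlim_ident)
  then have evr: "\<forall>\<^sub>F x in nhds 0. eval_fps (complex_fps (F oo G)) (of_real x)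
      = eval_fps (complex_fps F) (eval_fps (complex_fps G) (of_real x))"
    using ev by (auto simp: filterlim_iff)
  have "g 0 = 0" using has_fps_expansion_imp_0_eq_fps_nth_0[OF g] G0 by simp
  then have "(g \<longlongrightarrow> 0) (nhds 0)"
    using has_fps_expansion_imp_continuous[OF g, of UNIV] tendsto_at_iff_tendsto_nhds[of g 0]
    by (simp add: isCont_def)
  moreover have "\<forall>\<^sub>F y in nhds 0. ereal \<bar>y\<bar> < fps_conv_radius F \<and> eval_fps F y = f y"
    using small[OF r(1)] f by (auto simp: has_fps_expansion_def eventually_conj_iff)
  \<comment> \<open>The real and the complex evaluation of \<open>F\<close> are compared at
    \<open>g x\<close>, which must therefore stay inside the disc of convergence.\<close>
  ultimately have gF: "\<forall>\<^sub>F x in nhds 0. ereal \<bar>g x\<bar> < fps_conv_radius F \<and> eval_fps F (g x) = f (g x)"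
    by (auto simp: filterlim_iff)
  have gG: "\<forall>\<^sub>F x in nhds 0. eval_fps G x = g x" using g by (simp add: has_fps_expansion_def)
  have "\<forall>\<^sub>F x in nhds 0. eval_fps (F oo G) x = f (g x)"
    using evr gF gG small[OF r(2)] small[OF FG]
  proof eventually_elim
    case (elim x)
    then have "complex_of_real (eval_fps (F oo G) x) = of_real (f (g x))"
      by (simp add: eval_complex_fps)
    then show ?case by simp
  qed
  then show ?thesis using FG by (simp add: has_fps_expansion_def)
qed

lemma fps_nth_fps_expansion_real:
  fixes f :: "real \<Rightarrow> real"
  assumes "f has_fps_expansion F"
  shows "F $ n = (deriv ^^ n) f 0 / fact n"
  using assms
proof (induction n arbitrary: f F)
  case 0
  then show ?case using has_fps_expansion_imp_0_eq_fps_nth_0[of f F] by simp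
next
  case (Suc n)
  have "fps_deriv F $ n = (deriv ^^ n) (deriv f) 0 / fact n"
    by (rule Suc.IH[OF has_fps_expansion_deriv[OF Suc.prems]])
  then show ?case by (simp add: funpow_swap1 field_simps del: of_nat_Suc)
qed

lemma has_fps_expansion_unique_real:
  fixes f :: "real \<Rightarrow> real"
  assumes "f has_fps_expansion F" "f has_fps_expansion G"
  shows "F = G"
  by (rule fps_ext) (simp add: fps_nth_fps_expansion_real[OF assms(1)] fps_nth_fps_expansion_real[OF assms(2)])

lemma higher_deriv_translate:
  fixes f :: "real \<Rightarrow> real"
  shows "(deriv ^^ k) (\<lambda>h. f (a + h)) = (\<lambda>h. (deriv ^^ k) f (a + h))"
proof (induction k)
  case (Suc k)
  have *: "deriv (\<lambda>h. g (a + h)) h = deriv g (a + h)" for g :: "real \<Rightarrow> real" and h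
    unfolding deriv_def using DERIV_shift[of g _ h a] by (simp add: add.commute)
  show ?case by (rule ext) (simp add: Suc.IH *)
qed simp

section \<open>Compactly supported measures and the kernel family\<close>

definition moment_fps :: "real measure \<Rightarrow> real fps" where
  "moment_fps \<nu> = Abs_fps (\<lambda>n. \<integral>x. x ^ n \<partial>\<nu>)"

lemma compactly_supported_iff_AE_bounded:
  assumes "prob_space \<nu>" "sets \<nu> = sets borel"
  shows "compactly_supported \<nu> \<longleftrightarrow> (\<exists>r. AE x in \<nu>. \<bar>x\<bar> \<le> r)"
proof -
  interpret prob_space \<nu> by fact
  show ?thesis
  proof
    assume "compactly_supported \<nu>"
    then obtain K where K: "compact K" "prob K = 1" unfolding compactly_supported_def by blast
    obtain r where r: "\<And>x. x \<in> K \<Longrightarrow> \<bar>x\<bar> \<le> r"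
      using compact_imp_bounded[OF K(1)] unfolding bounded_iff by auto
    have "AE x in \<nu>. x \<in> K" using K(2) by (rule AE_prob_1)
    then have "AE x in \<nu>. \<bar>x\<bar> \<le> r" by eventually_elim (rule r)
    then show "\<exists>r. AE x in \<nu>. \<bar>x\<bar> \<le> r" ..
  next
    assume "\<exists>r. AE x in \<nu>. \<bar>x\<bar> \<le> r"
    then obtain r where "AE x in \<nu>. \<bar>x\<bar> \<le> r" ..
    then have "AE x in \<nu>. x \<in> {-r..r}" by eventually_elim auto
    moreover have "{-r..r} \<in> sets \<nu>" unfolding assms(2) by simp
    ultimately have "prob {-r..r} = 1" using prob_eq_1 by simp
    then show "compactly_supported \<nu>" unfolding compactly_supported_def by (intro exI[of _ "{-r..r}"]) simp
  qed
qed

text \<open>A geometric series integrated term by term: for \<open>\<bar>u\<bar> < 1 / s\<close> it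
  is dominated by the powers of \<open>q < 1\<close>.\<close>

lemma has_fps_expansion_moment_fps:
  assumes "prob_space \<nu>" and sets: "sets \<nu> = sets borel" and "AE x in \<nu>. \<bar>x\<bar> \<le> r"
  shows "(\<lambda>u. \<integral>x. 1 / (1 - u * x) \<partial>\<nu>) has_fps_expansion moment_fps \<nu>"
proof (rule has_fps_expansionI)
  interpret prob_space \<nu> by fact
  note [measurable_cong] = sets
  \<comment> \<open>The maximum with 1 makes \<open>1 / s\<close> a positive radius.\<close>
  define s where "s = max r 1"
  have s: "s > 0" unfolding s_def by simp
  have bs: "AE x in \<nu>. \<bar>x\<bar> \<le> s" using assms(3) by eventually_elim (simp add: s_def)
  have "eventually (\<lambda>u. u \<in> ball 0 (1 / s)) (nhds (0::real))"
    using s by (intro eventually_nhds_in_open) auto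
  then show "\<forall>\<^sub>F u in nhds 0. (\<lambda>n. moment_fps \<nu> $ n * u ^ n) sums (\<integral>x. 1 / (1 - u * x) \<partial>\<nu>)"
  proof eventually_elim
    case (elim u)
    define q where "q = \<bar>u\<bar> * s"
    have q: "0 \<le> q" "q < 1" using elim s by (auto simp: q_def field_simps)
    have sq: "summable (\<lambda>n. q ^ n)" using q by (intro summable_geometric) simp
    have b: "AE x in \<nu>. \<bar>u * x\<bar> \<le> q"
      using bs by eventually_elim (simp add: q_def abs_mult mult_left_mono)
    then have bn: "AE x in \<nu>. norm ((u * x) ^ n) \<le> q ^ n" for n
      by eventually_elim (simp add: power_abs power_mono flip: abs_mult)
    have int: "integrable \<nu> (\<lambda>x. (u * x) ^ n)" for n
      by (rule integrable_const_bound[OF bn]) measurable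
    have "(\<lambda>n. \<integral>x. (u * x) ^ n \<partial>\<nu>) sums (\<integral>x. (\<Sum>n. (u * x) ^ n) \<partial>\<nu>)"
    proof (rule sums_integral[OF int])
      show "AE x in \<nu>. summable (\<lambda>n. norm ((u * x) ^ n))"
        using b
      proof eventually_elim
        case (elim x)
        then show ?case using q unfolding norm_power by (intro summable_geometric) simp
      qed
      show "summable (\<lambda>n. \<integral>x. norm ((u * x) ^ n) \<partial>\<nu>)"
      proof (rule summable_comparison_test'[OF sq])
        fix n
        have "(\<integral>x. norm ((u * x) ^ n) \<partial>\<nu>) \<le> (\<integral>x. q ^ n \<partial>\<nu>)"
          using bn by (intro integral_mono_AE integrable_norm int) auto
        then show "norm (\<integral>x. norm ((u * x) ^ n) \<partial>\<nu>) \<le> q ^ n"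
          by (simp add: integral_nonneg prob_space)
      qed
    qed
    also have "(\<integral>x. (\<Sum>n. (u * x) ^ n) \<partial>\<nu>) = (\<integral>x. 1 / (1 - u * x) \<partial>\<nu>)"
    proof (rule integral_cong_AE)
      show "AE x in \<nu>. (\<Sum>n. (u * x) ^ n) = 1 / (1 - u * x)"
        using b
      proof eventually_elim
        case (elim x)
        then show ?case using q by (intro suminf_geometric) simp
      qed
    qed measurable
    also have "(\<lambda>n. \<integral>x. (u * x) ^ n \<partial>\<nu>) = (\<lambda>n. moment_fps \<nu> $ n * u ^ n)"
      by (simp add: power_mult_distrib moment_fps_def mult.commute)
    finally show ?case .
  qed
qed

text \<open>A positive radius bounds the moment of order 2n by C / \<rho>^(2n). Markov's inequality
  for these even powers then leaves no mass beyond a bound larger than 1 / \<rho>.\<close>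

lemma AE_bounded_of_moment_fps:
  assumes "prob_space \<nu>" "sets \<nu> = sets borel" and int: "\<And>n. integrable \<nu> (\<lambda>x. x ^ n)"
    and "fps_conv_radius (moment_fps \<nu>) > 0"
  obtains r where "AE x in \<nu>. \<bar>x\<bar> \<le> r"
proof -
  interpret prob_space \<nu> by fact
  note [measurable_cong] = assms(2)
  obtain \<rho> :: real where \<rho>: "\<rho> > 0" "ereal \<rho> < fps_conv_radius (moment_fps \<nu>)"
    using ereal_dense2[OF assms(4)] by auto
  have "summable (\<lambda>n. moment_fps \<nu> $ n * \<rho> ^ n)"
    using \<rho> by (intro summable_fps) simp
  then have "Bseq (\<lambda>n. moment_fps \<nu> $ n * \<rho> ^ n)"
    by (intro convergent_imp_Bseq summable_LIMSEQ_zero[THEN convergentI])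
  then obtain C where C: "\<And>n. \<bar>moment_fps \<nu> $ n * \<rho> ^ n\<bar> \<le> C" by (auto simp: Bseq_def)
  \<comment> \<open>Twice the growth rate 1 / \<rho> of the moments, which leaves a factor
    \<open>(1 / 4) ^ n\<close> in the Markov bound.\<close>
  define s where "s = 2 / \<rho>"
  have s: "s > 0" unfolding s_def using \<rho> by simp
  have "prob {x. s \<le> \<bar>x\<bar>} \<le> C * (1 / 4) ^ n" for n
  proof -
    have "prob {x. s \<le> \<bar>x\<bar>} \<le> prob {x \<in> space \<nu>. s ^ (2 * n) \<le> x ^ (2 * n)}"
    proof (rule finite_measure_mono)
      have "space \<nu> = UNIV" using sets_eq_imp_space_eq[OF assms(2)] by simp
      moreover have "s ^ (2 * n) \<le> x ^ (2 * n)" if "s \<le> \<bar>x\<bar>" for x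
        using power_mono[OF that, of "2 * n"] s by (simp add: power_even_abs)
      ultimately show "{x. s \<le> \<bar>x\<bar>} \<subseteq> {x \<in> space \<nu>. s ^ (2 * n) \<le> x ^ (2 * n)}" by auto
    qed measurable
    also have "\<dots> \<le> (\<integral>x. x ^ (2 * n) \<partial>\<nu>) / s ^ (2 * n)"
      using s by (intro integral_Markov_inequality_measure[OF int, of "{}"]) auto
    also have "\<dots> = (moment_fps \<nu> $ (2 * n) * \<rho> ^ (2 * n)) * (1 / 4) ^ n"
    proof -
      have e: "1 / s ^ (2 * n) = \<rho> ^ (2 * n) * (1 / 4) ^ n"
      proof -
        have "1 / s ^ (2 * n) = (\<rho> * (1 / 2)) ^ (2 * n)"
          unfolding s_def power_one_over[symmetric] by simp
        also have "\<dots> = \<rho> ^ (2 * n) * ((1 / 2) ^ 2) ^ n"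
          unfolding power_mult_distrib power_mult[symmetric] ..
        also have "(1 / 2 :: real) ^ 2 = 1 / 4" by (simp add: power2_eq_square)
        finally show ?thesis .
      qed
      have "(\<integral>x. x ^ (2 * n) \<partial>\<nu>) / s ^ (2 * n) = moment_fps \<nu> $ (2 * n) * (1 / s ^ (2 * n))"
        by (simp only: moment_fps_def fps_nth_Abs_fps times_divide_eq_right mult_1_right)
      then show ?thesis unfolding e mult.assoc .
    qed
    also have "\<dots> \<le> C * (1 / 4) ^ n"
      using C[of "2 * n"] by (intro mult_right_mono) auto
    finally show ?thesis .
  qed
  moreover have "(\<lambda>n. C * (1 / 4) ^ n) \<longlonglongrightarrow> C * 0"
    by (intro tendsto_mult tendsto_const LIMSEQ_power_zero) simp
  ultimately have "prob {x. s \<le> \<bar>x\<bar>} \<le> 0"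
    by (intro LIMSEQ_le_const[of _ 0]) auto
  then have "prob {x. s \<le> \<bar>x\<bar>} = 0" using measure_nonneg[of \<nu>] by (intro antisym) auto
  moreover have "{x. s \<le> \<bar>x\<bar>} \<in> events" by measurable
  ultimately have "AE x in \<nu>. x \<notin> {x. s \<le> \<bar>x\<bar>}" by (simp only: prob_eq_0)
  then have "AE x in \<nu>. \<bar>x\<bar> \<le> s" by eventually_elim auto
  then show thesis by (rule that)
qed

section \<open>Mass, mean and variance of the kernel family\<close>

lemma has_fps_expansion_eventually_eq_iff:
  fixes f g :: "real \<Rightarrow> real"
  assumes f: "f has_fps_expansion F" and g: "g has_fps_expansion G"
  shows "(\<forall>\<^sub>F x in nhds 0. f x = g x) \<longleftrightarrow> F = G"
proof
  assume "\<forall>\<^sub>F x in nhds 0. f x = g x"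
  then have "f has_fps_expansion G" using g
    by (subst has_fps_expansion_cong[of f g G G]) auto
  then show "F = G" by (rule has_fps_expansion_unique_real[OF f])
next
  assume "F = G"
  have "\<forall>\<^sub>F x in nhds 0. eval_fps F x = f x" "\<forall>\<^sub>F x in nhds 0. eval_fps G x = g x"
    using f g by (auto simp: has_fps_expansion_def)
  then show "\<forall>\<^sub>F x in nhds 0. f x = g x"
    by eventually_elim (use \<open>F = G\<close> in simp)
qed

text \<open>With \<open>\<theta> = (m - m0) / V m\<close>, \<open>N = 1 + \<theta> m\<close> and \<open>u = \<theta> / N\<close>, the kernel is
  \<open>1 / (N (1 - u x))\<close>, so its integral is \<open>1 / N\<close> times the moment series at \<open>u\<close>.\<close>
lemma kernel_mass_iff:
  assumes prob: "prob_space \<nu>" "sets \<nu> = sets borel" "AE x in \<nu>. \<bar>x\<bar> \<le> r"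
    and \<phi>: "(\<lambda>h. V (m0 + h)) has_fps_expansion \<phi>" "\<phi> $ 0 \<noteq> 0"
  defines "F \<equiv> fps_X * inverse \<phi>"
  defines "N \<equiv> 1 + F * (fps_const m0 + fps_X)"
  shows "(\<forall>\<^sub>F h in nhds 0. (\<integral>x. kernel_density V m0 (m0 + h) x \<partial>\<nu>) = 1) \<longleftrightarrow>
    moment_fps \<nu> oo (F * inverse N) = N"
proof -
  define \<theta> where "\<theta> h = h * inverse (V (m0 + h))" for h
  define n where "n h = 1 + \<theta> h * (m0 + h)" for h
  define g where "g u = (\<integral>x. 1 / (1 - u * x) \<partial>\<nu>)" for u
  have F: "\<theta> has_fps_expansion F"
    unfolding \<theta>_def[abs_def] F_def by (intro fps_expansion_intros \<phi>)
  have N: "n has_fps_expansion N"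
    unfolding n_def[abs_def] N_def by (intro fps_expansion_intros F)
  have N0: "N $ 0 \<noteq> 0" unfolding N_def F_def by simp
  have "(\<lambda>h. \<theta> h * inverse (n h)) has_fps_expansion F * inverse N"
    by (intro fps_expansion_intros F N N0)
  moreover have "g has_fps_expansion moment_fps \<nu>"
    unfolding g_def[abs_def] by (rule has_fps_expansion_moment_fps[OF prob])
  ultimately have gN: "(\<lambda>h. g (\<theta> h * inverse (n h))) has_fps_expansion (moment_fps \<nu> oo (F * inverse N))"
    by (intro has_fps_expansion_compose_real[of g]) (auto simp: F_def)
  \<comment> \<open>Applied to \<open>V\<close> and \<open>n\<close>, which thus do not vanish near
    the origin, so that dividing by them is legitimate.\<close>
  have nz: "\<forall>\<^sub>F x in nhds 0. f x \<noteq> 0" if "f has_fps_expansion G" "G $ 0 \<noteq> 0" for f :: "real \<Rightarrow> real" and G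
  proof -
    have "(f \<longlongrightarrow> f 0) (nhds 0)"
      using has_fps_expansion_imp_continuous[OF that(1), of UNIV] tendsto_at_iff_tendsto_nhds[of f 0]
      by (simp add: isCont_def)
    moreover have "f 0 \<noteq> 0" using has_fps_expansion_imp_0_eq_fps_nth_0[OF that(1)] that(2) by simp
    ultimately show ?thesis by (rule tendsto_imp_eventually_ne)
  qed
  have "\<forall>\<^sub>F h in nhds 0. (\<integral>x. kernel_density V m0 (m0 + h) x \<partial>\<nu>) = g (\<theta> h * inverse (n h)) / n h"
    using nz[OF \<phi>] nz[OF N N0]
  proof eventually_elim
    case (elim h)
    define v where "v = V (m0 + h)"
    have v: "v \<noteq> 0" and nh: "n h \<noteq> 0" using elim by (auto simp: v_def)
    have den: "v * n h * (1 - \<theta> h * inverse (n h) * x) = v + h * (m0 + h - x)" for x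
    proof -
      have "v * n h * (1 - \<theta> h * inverse (n h) * x) = v * n h - v * \<theta> h * x"
        using nh by (simp add: field_simps)
      also have "\<dots> = v + (v * \<theta> h) * (m0 + h - x)"
        by (simp add: n_def algebra_simps)
      also have "v * \<theta> h = h" using v by (simp add: \<theta>_def flip: v_def)
      finally show ?thesis .
    qed
    \<comment> \<open>This holds for every \<open>x\<close>: where the denominator vanishes, both
      sides are 0 by the convention for division.\<close>
    have kd: "kernel_density V m0 (m0 + h) x = (1 / (1 - \<theta> h * inverse (n h) * x)) / n h" for x
    proof -
      have "kernel_density V m0 (m0 + h) x = v / (v * (n h * (1 - \<theta> h * inverse (n h) * x)))"
        unfolding mult.assoc[symmetric, of v] den by (simp add: kernel_density_def v_def)
      also have "\<dots> = 1 / (n h * (1 - \<theta> h * inverse (n h) * x))"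
        by (rule nonzero_divide_mult_cancel_left[OF v])
      finally show ?thesis by (simp only: divide_divide_eq_left mult.commute[of "n h"])
    qed
    have "(\<integral>x. kernel_density V m0 (m0 + h) x \<partial>\<nu>) = (\<integral>x. (1 / (1 - \<theta> h * inverse (n h) * x)) / n h \<partial>\<nu>)"
      by (rule Bochner_Integration.integral_cong[OF refl kd])
    also have "\<dots> = g (\<theta> h * inverse (n h)) / n h"
      unfolding g_def by (rule integral_divide_zero)
    finally show ?case .
  qed
  with nz[OF N N0] have "\<forall>\<^sub>F h in nhds 0.
      ((\<integral>x. kernel_density V m0 (m0 + h) x \<partial>\<nu>) = 1) = (g (\<theta> h * inverse (n h)) = n h)"
    by eventually_elim auto
  then have "(\<forall>\<^sub>F h in nhds 0. (\<integral>x. kernel_density V m0 (m0 + h) x \<partial>\<nu>) = 1)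
      = (\<forall>\<^sub>F h in nhds 0. g (\<theta> h * inverse (n h)) = n h)"
    by (rule eventually_subst)
  also have "\<dots> \<longleftrightarrow> moment_fps \<nu> oo (F * inverse N) = N"
    by (rule has_fps_expansion_eventually_eq_iff[OF gN N])
  finally show ?thesis .
qed

lemma kernel_density_measurable [measurable]: "kernel_density V m0 m \<in> borel_measurable borel"
  unfolding kernel_density_def[abs_def] by measurable

text \<open>The mass of \<open>Q\<close> is the integral of the density truncated by
  \<open>ennreal\<close>; nonnegativity almost everywhere turns it into the integral of the density
  itself.\<close>

lemma integral_kernel_density_eq_1:
  assumes "sets \<nu> = sets borel" "AE x in \<nu>. kernel_density V m0 m x \<ge> 0" "prob_space (Q V m0 \<nu> m)"
  shows "(\<integral>x. kernel_density V m0 m x \<partial>\<nu>) = 1"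
proof -
  note [measurable_cong] = assms(1)
  interpret q: prob_space "Q V m0 \<nu> m" by fact
  have "(\<integral>\<^sup>+x. ennreal (kernel_density V m0 m x) \<partial>\<nu>) = emeasure (Q V m0 \<nu> m) (space \<nu>)"
    unfolding Q_def by (subst emeasure_density) (auto intro!: nn_integral_cong)
  also have "\<dots> = 1" using q.emeasure_space_1 by (simp add: Q_def)
  finally have "(\<integral>\<^sup>+x. ennreal (kernel_density V m0 m x) \<partial>\<nu>) = 1" .
  then show ?thesis by (subst integral_eq_nn_integral[OF _ assms(2)]) simp_all
qed

text \<open>With \<open>k\<close> the kernel and \<open>\<theta> = (m - m0) / V m\<close>, the identity \<open>k x (1 + \<theta> (m - x)) = 1\<close>
  turns \<open>\<integral>k = 1\<close> into \<open>\<integral>k x (m - x) = 0\<close>, and, multiplied by \<open>m - x\<close>, yields the variance.\<close>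
lemma kernel_family_member:
  assumes "prob_space \<nu>" and sets: "sets \<nu> = sets borel" and r: "AE x in \<nu>. \<bar>x\<bar> \<le> r"
    and Vm: "V m > 0" and small: "\<bar>m - m0\<bar> * (\<bar>m\<bar> + r) \<le> V m / 2"
    and mass: "(\<integral>x. kernel_density V m0 m x \<partial>\<nu>) = 1"
    and mean: "(\<integral>x. x \<partial>\<nu>) = m0" and var: "m = m0 \<Longrightarrow> (\<integral>x. (x - m0)\<^sup>2 \<partial>\<nu>) = V m0"
  shows "mean_parameterized_family V m0 \<nu> {m}"
proof -
  interpret prob_space \<nu> by fact
  note [measurable_cong] = sets
  define k where "k = kernel_density V m0 m"
  define \<theta> where "\<theta> = (m - m0) / V m"
  \<comment> \<open>The smallness assumption keeps the denominator away from 0, so the kernel lies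
    between 0 and 2 and all integrals below exist.\<close>
  have den: "AE x in \<nu>. V m + (m - m0) * (m - x) \<ge> V m / 2"
    using r
  proof eventually_elim
    case (elim x)
    have "\<bar>(m - m0) * (m - x)\<bar> \<le> \<bar>m - m0\<bar> * (\<bar>m\<bar> + r)"
      unfolding abs_mult using elim by (intro mult_left_mono) auto
    then show ?case using small by linarith
  qed
  have k: "AE x in \<nu>. k x > 0 \<and> k x \<le> 2 \<and> k x * (1 + \<theta> * (m - x)) = 1"
    using den
  proof eventually_elim
    case (elim x)
    have "1 + \<theta> * (m - x) = (V m + (m - m0) * (m - x)) / V m"
      unfolding \<theta>_def using Vm by (simp add: field_simps)
    then show ?case using elim Vm unfolding k_def kernel_density_def by (simp add: pos_divide_le_eq)
  qed
  have [measurable]: "k \<in> borel_measurable borel" unfolding k_def by measurable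
  have k0: "AE x in \<nu>. k x \<ge> 0" using k by eventually_elim simp
  have int: "integrable \<nu> (\<lambda>x. k x * (x - m) ^ j)" for j
  proof (rule integrable_const_bound)
    show "AE x in \<nu>. norm (k x * (x - m) ^ j) \<le> 2 * (r + \<bar>m\<bar>) ^ j"
      using k r
    proof eventually_elim
      case (elim x)
      have "\<bar>x - m\<bar> ^ j \<le> (r + \<bar>m\<bar>) ^ j" using elim by (intro power_mono) auto
      then show ?case using elim by (auto simp: abs_mult power_abs intro!: mult_mono)
    qed
  qed measurable
  have "integrable \<nu> (\<lambda>x. x)"
    by (rule integrable_const_bound[of _ r]) (use r in simp_all)
  \<comment> \<open>The kernel identity multiplied by \<open>(x - m) ^ j\<close>:
    \<open>j = 0\<close> links mass and mean, \<open>j = 1\<close> mean and variance.\<close>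
  have rec: "(\<integral>x. k x * (x - m) ^ j \<partial>\<nu>) - \<theta> * (\<integral>x. k x * (x - m) ^ Suc j \<partial>\<nu>) = (\<integral>x. (x - m) ^ j \<partial>\<nu>)" for j
  proof -
    have "(\<integral>x. k x * (x - m) ^ j \<partial>\<nu>) - \<theta> * (\<integral>x. k x * (x - m) ^ Suc j \<partial>\<nu>)
        = (\<integral>x. k x * (x - m) ^ j - \<theta> * (k x * (x - m) ^ Suc j) \<partial>\<nu>)"
      using int[of j] int[of "Suc j"] by simp
    also have "\<dots> = (\<integral>x. (x - m) ^ j \<partial>\<nu>)"
    proof (rule integral_cong_AE)
      show "AE x in \<nu>. k x * (x - m) ^ j - \<theta> * (k x * (x - m) ^ Suc j) = (x - m) ^ j"
        using k
      proof eventually_elim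
        case (elim x)
        have "k x * (x - m) ^ j - \<theta> * (k x * (x - m) ^ Suc j) = (k x * (1 + \<theta> * (m - x))) * (x - m) ^ j"
          by (simp add: algebra_simps)
        then show ?case using elim by simp
      qed
    qed measurable
    finally show ?thesis .
  qed
  have mass': "(\<integral>x. k x \<partial>\<nu>) = 1" using mass unfolding k_def .
  have k1: "(\<integral>x. k x * (x - m) \<partial>\<nu>) = 0" and k2: "(\<integral>x. k x * (x - m) ^ 2 \<partial>\<nu>) = V m"
  proof -
    have *: "(\<integral>x. k x * (x - m) \<partial>\<nu>) = 0 \<and> (\<integral>x. k x * (x - m) ^ 2 \<partial>\<nu>) = V m"
    proof (cases "m = m0")
      \<comment> \<open>Here \<theta> = 0, and the recursion says nothing about the next moment; but
        the kernel is 1 and the variance is that of \<nu>.\<close>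
      case True
      then have "k = (\<lambda>x. 1)" using Vm by (simp add: k_def kernel_density_def fun_eq_iff)
      then show ?thesis using True var mean \<open>integrable \<nu> (\<lambda>x. x)\<close> by (simp add: prob_space)
    next
      case False
      then have "\<theta> \<noteq> 0" using Vm by (simp add: \<theta>_def)
      then have 1: "(\<integral>x. k x * (x - m) \<partial>\<nu>) = 0" using rec[of 0] mass' by (simp add: prob_space)
      have "\<theta> * (\<integral>x. k x * (x - m) ^ 2 \<partial>\<nu>) = - (\<integral>x. x - m \<partial>\<nu>)"
        using rec[of 1] 1 by (simp add: power2_eq_square)
      also have "\<dots> = m - m0" using mean \<open>integrable \<nu> (\<lambda>x. x)\<close> by (simp add: prob_space)
      also have "\<dots> = \<theta> * V m" using Vm by (simp add: \<theta>_def)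
      finally show ?thesis using 1 \<open>\<theta> \<noteq> 0\<close> by simp
    qed
    show "(\<integral>x. k x * (x - m) \<partial>\<nu>) = 0" "(\<integral>x. k x * (x - m) ^ 2 \<partial>\<nu>) = V m" using * by simp_all
  qed
  have intk: "integrable \<nu> k" "integrable \<nu> (\<lambda>x. k x * (x - m))" "integrable \<nu> (\<lambda>x. k x * (x - m)\<^sup>2)"
    using int[of 0] int[of 1] int[of 2] by simp_all
  have Qk: "Q V m0 \<nu> m = density \<nu> (\<lambda>x. ennreal (k x))" unfolding Q_def k_def ..
  have dens_int: "integrable (Q V m0 \<nu> m) f \<longleftrightarrow> integrable \<nu> (\<lambda>x. k x * f x)"
    and dens_eq: "(\<integral>x. f x \<partial>Q V m0 \<nu> m) = (\<integral>x. k x * f x \<partial>\<nu>)"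
    if "f \<in> borel_measurable borel" for f :: "real \<Rightarrow> real"
  proof -
    have [measurable]: "f \<in> borel_measurable \<nu>" using that by measurable
    show "integrable (Q V m0 \<nu> m) f \<longleftrightarrow> integrable \<nu> (\<lambda>x. k x * f x)"
      unfolding Qk by (subst integrable_density[OF _ _ k0]) simp_all
    show "(\<integral>x. f x \<partial>Q V m0 \<nu> m) = (\<integral>x. k x * f x \<partial>\<nu>)"
      unfolding Qk by (subst integral_density[OF _ _ k0]) simp_all
  qed
  have kx: "(\<lambda>x. k x * x) = (\<lambda>x. k x * (x - m) + m * k x)" by (auto simp: algebra_simps)
  have "emeasure (Q V m0 \<nu> m) (space (Q V m0 \<nu> m)) = (\<integral>\<^sup>+x. ennreal (k x) \<partial>\<nu>)"
    unfolding Qk by (simp add: emeasure_density cong: nn_integral_cong)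
  also have "\<dots> = 1" using nn_integral_eq_integral[OF intk(1) k0] mass' by simp
  finally have "prob_space (Q V m0 \<nu> m)" by (rule prob_spaceI)
  moreover have "AE x in \<nu>. V m + (m - m0) * (m - x) \<noteq> 0 \<and> kernel_density V m0 m x \<ge> 0"
    using den k by eventually_elim (use Vm in \<open>auto simp: k_def\<close>)
  moreover have "integrable (Q V m0 \<nu> m) (\<lambda>x. x)" "(\<integral>x. x \<partial>Q V m0 \<nu> m) = m"
    using intk(1,2) k1 mass' by (simp_all add: dens_int dens_eq kx)
  moreover have "integrable (Q V m0 \<nu> m) (\<lambda>x. (x - m)\<^sup>2)" "(\<integral>x. (x - m)\<^sup>2 \<partial>Q V m0 \<nu> m) = V m"
    using intk(3) k2 by (simp_all add: dens_int dens_eq)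
  ultimately show ?thesis unfolding mean_parameterized_family_def by simp
qed

text \<open>The condition on the R-transform says that \<open>W\<close>, which is R - m0, inverts F,
  so Lagrange inversion applies. The cumulant of index \<open>n + 1\<close> is coefficient
  \<open>n\<close> of R, and the factor 1/n of Lagrange completes the \<open>fact (n - 1)\<close> of
  Taylor to \<open>fact n\<close>.\<close>

lemma lagrange_coefficients_iff:
  fixes V :: "real \<Rightarrow> real"
  assumes \<phi>: "(\<lambda>h. V (m0 + h)) has_fps_expansion \<phi>" "\<phi> $ 0 \<noteq> 0"
  shows "(c 1 = m0 \<and> (\<forall>n\<ge>1. c (n + 1) = (deriv ^^ (n - 1)) (\<lambda>x. V x ^ n) m0 / fact n)) \<longleftrightarrow>
    Abs_fps (\<lambda>k. c (Suc k)) oo (fps_X * inverse \<phi>) = fps_const m0 + fps_X"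
proof -
  define W where "W = Abs_fps (\<lambda>k. c (Suc k)) - fps_const m0"
  have coeff: "(\<phi> ^ n) $ (n - 1) / real n = (deriv ^^ (n - 1)) (\<lambda>x. V x ^ n) m0 / fact n" if "n \<ge> 1" for n
  proof -
    have "(\<lambda>h. V (m0 + h) ^ n) has_fps_expansion \<phi> ^ n" by (intro has_fps_expansion_power \<phi>)
    then have "(\<phi> ^ n) $ (n - 1) = (deriv ^^ (n - 1)) (\<lambda>h. V (m0 + h) ^ n) 0 / fact (n - 1)"
      by (rule fps_nth_fps_expansion_real)
    also have "(deriv ^^ (n - 1)) (\<lambda>h. V (m0 + h) ^ n) 0 = (deriv ^^ (n - 1)) (\<lambda>x. V x ^ n) m0"
      using higher_deriv_translate[of "n - 1" "\<lambda>x. V x ^ n" m0] by simp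
    finally show ?thesis using that by (simp add: fact_reduce[of n] mult.commute)
  qed
  have "W oo (fps_X * inverse \<phi>) = fps_X \<longleftrightarrow> W $ 0 = 0 \<and> (\<forall>n\<ge>1. W $ n = (\<phi> ^ n) $ (n - 1) / real n)"
    by (rule lagrange_inversion_iff[OF \<phi>(2)])
  moreover have "W $ 0 = 0 \<longleftrightarrow> c 1 = m0" by (simp add: W_def)
  moreover have "W $ n = c (n + 1)" if "n \<ge> 1" for n using that by (simp add: W_def)
  moreover have "W oo (fps_X * inverse \<phi>) = (Abs_fps (\<lambda>k. c (Suc k)) oo (fps_X * inverse \<phi>)) - fps_const m0"
    by (simp add: W_def fps_compose_sub_distrib)
  ultimately show ?thesis using coeff by (auto simp: algebra_simps)
qed

text \<open>A compositional left inverse of F is also a right inverse; composing F \<phi> = X with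
  \<open>W\<close> then gives the equation.\<close>

lemma fps_compose_inverse_fixpoint:
  fixes W \<phi> :: "real fps"
  assumes \<phi>: "\<phi> $ 0 \<noteq> 0" and W: "W oo (fps_X * inverse \<phi>) = fps_X"
  shows "W = fps_X * (\<phi> oo W)"
proof -
  define F where "F = fps_X * inverse \<phi>"
  have F: "F $ 0 = 0" "F $ 1 \<noteq> 0" unfolding F_def using \<phi> by simp_all
  have W0: "W $ 0 = 0" using lagrange_inversion_iff[OF \<phi>] W by blast
  have I: "fps_inv F $ 0 = 0" by (simp add: fps_inv_def)
  have "(F oo W) oo F = F" 
    unfolding fps_compose_assoc[OF F(1) W0, symmetric] W[folded F_def] by simp
  then have "((F oo W) oo F) oo fps_inv F = F oo fps_inv F" by simp
  then have "(F oo W) oo (F oo fps_inv F) = F oo fps_inv F"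
    by (simp add: fps_compose_assoc[OF I F(1)])
  then have FW: "F oo W = fps_X" using fps_inv_right[OF F] by simp
  have "F * \<phi> = fps_X" using \<phi> by (simp add: F_def mult.assoc inverse_mult_eq_1)
  then have "(F oo W) * (\<phi> oo W) = fps_X oo W"
    using fps_compose_mult_distrib[OF W0, of F \<phi>] by simp
  then show ?thesis using FW W0 by simp
qed

text \<open>The series C of the fixed point equation is \<phi> for R - m0 and then 1 + X R for X M,
  so the second application rests on the first.\<close>

lemma fps_conv_radius_of_cumulants:
  fixes M R \<phi> :: "real fps"
  assumes M: "M = 1 + fps_X * M * (R oo (fps_X * M))"
    and \<phi>: "\<phi> $ 0 \<noteq> 0" "fps_conv_radius \<phi> > 0"
    and R: "R oo (fps_X * inverse \<phi>) = fps_const m0 + fps_X"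
  shows "fps_conv_radius M > 0"
proof -
  define W where "W = R - fps_const m0"
  have "W oo (fps_X * inverse \<phi>) = fps_X" using R by (simp add: W_def fps_compose_sub_distrib)
  then have "W = fps_X * (\<phi> oo W)" by (rule fps_compose_inverse_fixpoint[OF \<phi>(1)])
  then have "fps_conv_radius W > 0" by (rule fps_conv_radius_fixpoint[OF _ \<phi>(2)])
  then have "(\<lambda>x. 1 + x * (eval_fps W x + m0)) has_fps_expansion 1 + fps_X * (W + fps_const m0)"
    by (intro fps_expansion_intros eval_fps_has_fps_expansion)
  moreover have "W + fps_const m0 = R" by (simp add: W_def)
  ultimately have "fps_conv_radius (1 + fps_X * R) > 0" by (simp add: has_fps_expansion_def)
  moreover have "fps_X * M = fps_X * ((1 + fps_X * R) oo (fps_X * M))"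
    using M by (simp add: fps_compose_add_distrib fps_compose_mult_distrib)
  ultimately have "fps_conv_radius (fps_X * M) > 0" by (rule fps_conv_radius_fixpoint[rotated])
  then have "fps_conv_radius (fps_shift 1 (fps_X * M)) > 0" by (simp only: fps_conv_radius_shift)
  moreover have "fps_shift 1 (fps_X * M) = M" by (rule fps_ext) simp
  ultimately show ?thesis by (simp only:)
qed

theorem theorem3p3:
  fixes m0 :: real and V :: "real \<Rightarrow> real" and U :: "real set" and \<nu> :: "real measure"
  assumes "open U" and "m0 \<in> U" and "real_analytic_on V U"
    and "V m0 > 0"
    and "real_distribution \<nu>"
    and "\<And>n :: nat. integrable \<nu> (\<lambda>x. x ^ n)"
    and "(\<integral>x. x \<partial>\<nu>) = m0"
  shows "(nondegenerate \<nu> \<and> compactly_supported \<nu> \<and>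
            (\<exists>A B. m0 \<in> {A<..<B} \<and> {A<..<B} \<subseteq> U \<and>
                   mean_parameterized_family V m0 \<nu> {A<..<B}))
         \<longleftrightarrow>
         (free_cumulant \<nu> 1 = m0 \<and>
            (\<forall>n\<ge>1. free_cumulant \<nu> (n + 1) =
                     (deriv ^^ (n - 1)) (\<lambda>x. V x ^ n) m0 / fact n))"
  (is "?family \<longleftrightarrow> ?cumulants")
proof -
  interpret real_distribution \<nu> by fact
  have ps: "prob_space \<nu>" "sets \<nu> = sets borel" by (unfold_locales, simp)
  note [measurable_cong] = ps(2)
  obtain \<phi> where \<phi>: "(\<lambda>h. V (m0 + h)) has_fps_expansion \<phi>"
    using assms(2,3) unfolding real_analytic_on_def by blast
  have \<phi>0: "\<phi> $ 0 = V m0" using has_fps_expansion_imp_0_eq_fps_nth_0[OF \<phi>] by simp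
  then have \<phi>nz: "\<phi> $ 0 \<noteq> 0" using assms(4) by simp
  define c where "c = free_cumulant \<nu>"
  define R where "R = Abs_fps (\<lambda>k. c (Suc k))"
  define M where "M = moment_fps \<nu>"
  have "nc_fps c = M"
    unfolding M_def moment_fps_def c_def
    by (rule nc_fps_moments[OF moment_cumulant_relations_free_cumulant ps(1)])
  then have M: "M = 1 + fps_X * M * (R oo (fps_X * M))"
    using nc_fps_functional_equation[of c] unfolding R_def by simp
  define F where "F = fps_X * inverse \<phi>"
  define N where "N = 1 + F * (fps_const m0 + fps_X)"
  have F: "F $ 0 = 0" "F $ 1 \<noteq> 0" unfolding F_def using \<phi>nz by simp_all
  have cumulants_iff: "?cumulants \<longleftrightarrow> R oo F = fps_const m0 + fps_X"
    unfolding R_def F_def c_def by (rule lagrange_coefficients_iff[OF \<phi> \<phi>nz])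
  also have "\<dots> \<longleftrightarrow> M oo (F * inverse N) = N"
    unfolding N_def by (rule moment_series_compose_iff[OF M F, symmetric])
  finally have formal: "?cumulants \<longleftrightarrow> M oo (F * inverse N) = N" .
  \<comment> \<open>This equivalence carries both directions. It presupposes a bound on the support,
    which is given on one side and has to be derived on the other.\<close>
  have mass_iff: "(\<forall>\<^sub>F h in nhds 0. (\<integral>x. kernel_density V m0 (m0 + h) x \<partial>\<nu>) = 1) \<longleftrightarrow> ?cumulants"
    if "AE x in \<nu>. \<bar>x\<bar> \<le> r" for r
    unfolding formal M_def N_def F_def by (rule kernel_mass_iff[OF ps that \<phi> \<phi>nz])
  show ?thesis
  proof
    assume ?family
    then obtain A B r where AB: "m0 \<in> {A<..<B}" "mean_parameterized_family V m0 \<nu> {A<..<B}"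
      and r: "AE x in \<nu>. \<bar>x\<bar> \<le> r"
      using compactly_supported_iff_AE_bounded[OF ps] by blast
    have "\<forall>\<^sub>F h in nhds 0. h \<in> {A - m0<..<B - m0}"
      using AB(1) by (intro eventually_nhds_in_open) auto
    then have "\<forall>\<^sub>F h in nhds 0. (\<integral>x. kernel_density V m0 (m0 + h) x \<partial>\<nu>) = 1"
    proof eventually_elim
      case (elim h)
      then have "m0 + h \<in> {A<..<B}" by auto
      then have "AE x in \<nu>. kernel_density V m0 (m0 + h) x \<ge> 0" "prob_space (Q V m0 \<nu> (m0 + h))"
        using AB(2) unfolding mean_parameterized_family_def by auto
      then show ?case by (rule integral_kernel_density_eq_1[OF ps(2)])
    qed
    then show ?cumulants using mass_iff[OF r] by blast
  next
    assume cum: ?cumulants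
    have "fps_conv_radius \<phi> > 0" using \<phi> by (simp add: has_fps_expansion_def)
    then have "fps_conv_radius M > 0"
      using fps_conv_radius_of_cumulants[OF M \<phi>nz] cum unfolding cumulants_iff F_def by blast
    then obtain r where r: "AE x in \<nu>. \<bar>x\<bar> \<le> r"
      using AE_bounded_of_moment_fps[OF ps assms(6)] unfolding M_def by blast
    \<comment> \<open>The variance at \<open>m = m0\<close>, which the mass does not determine: in
      degree 2 the functional equation says that the second moment is the second cumulant,
      \<open>V m0\<close>, plus the square of \<open>m0\<close>.\<close>
    have var: "(\<integral>x. (x - m0)\<^sup>2 \<partial>\<nu>) = V m0"
    proof -
      have M0: "M $ 0 = 1" and M1: "M $ 1 = m0" and M2: "M $ 2 = (\<integral>x. x\<^sup>2 \<partial>\<nu>)"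
        using assms(7) prob_space by (simp_all add: M_def moment_fps_def)
      define P where "P = fps_X * M"
      have P: "P $ 0 = 0" "P $ 1 = 1" using M0 by (simp_all add: P_def)
      have "(R oo P) $ 0 = R $ 0" "(R oo P) $ 1 = R $ 1" using P by (simp_all add: fps_compose_nth)
      moreover have "M $ 2 = M $ 0 * (R oo P) $ 1 + M $ 1 * (R oo P) $ 0"
        using arg_cong[OF M, of "\<lambda>f. f $ 2"] unfolding P_def[symmetric]
        by (simp add: mult.assoc fps_mult_nth numeral_2_eq_2 P_def)
      moreover have "R $ 0 = m0" "R $ 1 = V m0" using cum by (auto simp: R_def c_def)
      ultimately have "(\<integral>x. x\<^sup>2 \<partial>\<nu>) = V m0 + m0\<^sup>2" using M0 M1 M2 by (simp add: power2_eq_square)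
      moreover have "(\<integral>x. (x - m0)\<^sup>2 \<partial>\<nu>) = (\<integral>x. x\<^sup>2 - 2 * m0 * x + m0\<^sup>2 \<partial>\<nu>)"
        by (simp add: power2_diff algebra_simps)
      moreover have "integrable \<nu> (\<lambda>x. x)" "integrable \<nu> (\<lambda>x. x\<^sup>2)" using assms(6)[of 1] assms(6)[of 2] by simp_all
      ultimately show ?thesis using assms(7) prob_space by (simp add: power2_eq_square)
    qed
    have "nondegenerate \<nu>"
      unfolding nondegenerate_def
    proof
      assume "\<exists>a. \<nu> = return borel a"
      then obtain a where a: "\<nu> = return borel a" ..
      then have "a = m0" using assms(7) by (simp add: integral_return)
      then show False using var assms(4) unfolding a by (simp add: integral_return)
    qed
    moreover have "compactly_supported \<nu>"
      using r compactly_supported_iff_AE_bounded[OF ps] by blast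
    moreover have "\<exists>A B. m0 \<in> {A<..<B} \<and> {A<..<B} \<subseteq> U \<and> mean_parameterized_family V m0 \<nu> {A<..<B}"
    proof -
      have "((\<lambda>h. V (m0 + h)) \<longlongrightarrow> V (m0 + 0)) (nhds 0)"
        using has_fps_expansion_imp_continuous[OF \<phi>, of UNIV] tendsto_at_iff_tendsto_nhds[of "\<lambda>h. V (m0 + h)" 0]
        by (simp add: isCont_def)
      then have V: "((\<lambda>h. V (m0 + h)) \<longlongrightarrow> V m0) (nhds 0)" by simp
      \<comment> \<open>This is the smallness condition on the mean: at \<open>h = 0\<close> it
        compares 0 with \<open>V m0 / 2\<close>, so it persists nearby.\<close>
      have "((\<lambda>h. V (m0 + h) / 2 - \<bar>h\<bar> * (\<bar>m0 + h\<bar> + r)) \<longlongrightarrow> V m0 / 2 - \<bar>0\<bar> * (\<bar>m0 + 0\<bar> + r)) (nhds 0)"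
        by (intro tendsto_intros V filterlim_ident) simp
      then have "\<forall>\<^sub>F h in nhds 0. V (m0 + h) / 2 - \<bar>h\<bar> * (\<bar>m0 + h\<bar> + r) > 0"
        by (rule order_tendstoD(1)) (use assms(4) in simp)
      moreover have "\<forall>\<^sub>F h in nhds 0. V (m0 + h) > 0" using order_tendstoD(1)[OF V assms(4)] .
      moreover have "\<forall>\<^sub>F h in nhds 0. m0 + h \<in> U"
      proof -
        have "((\<lambda>h. m0 + h) \<longlongrightarrow> m0 + 0) (nhds 0)" by (intro tendsto_intros filterlim_ident)
        then show ?thesis using assms(1,2) by (intro topological_tendstoD) auto
      qed
      moreover have "\<forall>\<^sub>F h in nhds 0. (\<integral>x. kernel_density V m0 (m0 + h) x \<partial>\<nu>) = 1"
        using mass_iff[OF r] cum by blast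
      ultimately have "\<forall>\<^sub>F h in nhds 0. m0 + h \<in> U \<and> mean_parameterized_family V m0 \<nu> {m0 + h}"
      proof eventually_elim
        case (elim h)
        then have "mean_parameterized_family V m0 \<nu> {m0 + h}"
          using var by (intro kernel_family_member[OF ps r _ _ _ assms(7)]) auto
        then show ?case using elim by simp
      qed
      then obtain e where e: "e > 0"
        and fam: "\<And>h. \<bar>h\<bar> < e \<Longrightarrow> m0 + h \<in> U \<and> mean_parameterized_family V m0 \<nu> {m0 + h}"
        unfolding eventually_nhds_metric dist_real_def by auto
      have "m \<in> U \<and> mean_parameterized_family V m0 \<nu> {m}" if "m \<in> {m0 - e<..<m0 + e}" for m
        using fam[of "m - m0"] that by (simp add: abs_less_iff)
      \<comment> \<open>The defining condition is imposed on each mean separately, so the singletons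
        combine to an interval.\<close>
      then have "{m0 - e<..<m0 + e} \<subseteq> U" "mean_parameterized_family V m0 \<nu> {m0 - e<..<m0 + e}"
        unfolding mean_parameterized_family_def by (blast, simp)
      then show ?thesis using e by (intro exI[of _ "m0 - e"] exI[of _ "m0 + e"]) simp
    qed
    ultimately show ?family by blast
  qed
qed

end
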